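(* $\Delta_0(\ker\Delta_1)=\ell_f$ and $\Delta_0(\ker\Delta_1\cap\ker\Delta_2)=\ell_g$.
   Context: All spaces are complex. For the couple $(X_0,X_1)=(\ell_\infty,\ell_1)$ put $\Sigma=\ell_\infty+\ell_1$. The Calderón space $\mathcal C$ of the couple is the Banach space of bounded continuous functions $F:\{z\in\mathbb C:0\le \mathrm{Re}\,z\le 1\}\to\Sigma$, analytic on the open strip, such that for $j=0,1$ the map $t\mapsto F(j+it)$ is continuous from $\mathbb R$ into $X_j$ and tends to $0$ as $|t|\to\infty$, with norm $\|F\|=\max_{j=0,1}\sup_{t}\|F(j+it)\|_{X_j}$. For $k=0,1,2$ let $\Delta_k:\mathcal C\to\Sigma$, $\Delta_k(F)=F^{(k)}(1/2)/k!$. $\ell_f$ and $\ell_g$ are the Orlicz sequence spaces of the Orlicz functions which near $0$ are $f(t)=t^2\log^2t$ and $g(t)=t^2\log^4t$; that is, $\ell_f=\{x\in\ell_2:x\log|x|\in\ell_2\}$ and $\ell_g=\{x\in\ell_2:x\log^2|x|\in\ell_2\}$ (operations coordinatewise, with $0\log^k 0=0$). The space $T(K)$ carries the quotient norm $\|x\|=\inf\{\|F\|:F\in K,\ TF=x\}$, and equality means equality of sets of sequences with equivalence of norms. *)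

theory Defs
  imports "HOL-Analysis.Analysis"
begin

section \<open>Sequence spaces and the sum space\<close>

type_synonym cseq = "nat \<Rightarrow> complex"

definition ell_inf :: "cseq set" where
  "ell_inf = {x. bounded (range x)}"

definition norm_inf :: "cseq \<Rightarrow> real" where
  "norm_inf x = (SUP n. cmod (x n))"

definition ell_1 :: "cseq set" where
  "ell_1 = {x. summable (\<lambda>n. cmod (x n))}"

definition norm_1 :: "cseq \<Rightarrow> real" where
  "norm_1 x = (\<Sum>n. cmod (x n))"

definition ell_2 :: "cseq set" where
  "ell_2 = {x. summable (\<lambda>n. (cmod (x n))\<^sup>2)}"

definition Sigma_space :: "cseq set" where
  "Sigma_space = {(\<lambda>n. a n + b n) | a b. a \<in> ell_inf \<and> b \<in> ell_1}"

definition Sigma_norm :: "cseq \<Rightarrow> real" where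
  "Sigma_norm x =
     Inf {norm_inf a + norm_1 b | a b. a \<in> ell_inf \<and> b \<in> ell_1 \<and> x = (\<lambda>n. a n + b n)}"

section \<open>Vector-valued complex differentiation\<close>

definition Sigma_has_deriv :: "(complex \<Rightarrow> cseq) \<Rightarrow> cseq \<Rightarrow> complex \<Rightarrow> bool" where
  "Sigma_has_deriv F D z \<longleftrightarrow> D \<in> Sigma_space \<and>
     ((\<lambda>h. Sigma_norm (\<lambda>n. (F (z + h) n - F z n) / h - D n)) \<longlongrightarrow> 0) (at 0)"

definition Sigma_deriv :: "(complex \<Rightarrow> cseq) \<Rightarrow> complex \<Rightarrow> cseq" where
  "Sigma_deriv F z = (THE D. Sigma_has_deriv F D z)"

section \<open>The Calderon space of the couple\<close>

definition strip :: "complex set" where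
  "strip = {z. 0 \<le> Re z \<and> Re z \<le> 1}"

definition open_strip :: "complex set" where
  "open_strip = {z. 0 < Re z \<and> Re z < 1}"

definition vanishing_path :: "cseq set \<Rightarrow> (cseq \<Rightarrow> real) \<Rightarrow> (real \<Rightarrow> cseq) \<Rightarrow> bool" where
  "vanishing_path X N G \<longleftrightarrow>
     (\<forall>t. G t \<in> X) \<and>
     (\<forall>t. ((\<lambda>s. N (\<lambda>n. G s n - G t n)) \<longlongrightarrow> 0) (at t)) \<and>
     ((\<lambda>t. N (G t)) \<longlongrightarrow> 0) at_infinity"

text \<open>Functions on the strip are represented by total functions whose values off the strip are
  irrelevant: neither the norm nor the derivatives at interior points depend on them.\<close>

definition calderon :: "(complex \<Rightarrow> cseq) set" where
  "calderon = {F.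
     (\<forall>z\<in>strip. F z \<in> Sigma_space) \<and>
     (\<exists>B. \<forall>z\<in>strip. Sigma_norm (F z) \<le> B) \<and>
     (\<forall>z\<in>strip. ((\<lambda>w. Sigma_norm (\<lambda>n. F w n - F z n)) \<longlongrightarrow> 0) (at z within strip)) \<and>
     (\<forall>z\<in>open_strip. \<exists>D. Sigma_has_deriv F D z) \<and>
     vanishing_path ell_inf norm_inf (\<lambda>t. F (Complex 0 t)) \<and>
     vanishing_path ell_1 norm_1 (\<lambda>t. F (Complex 1 t))}"

definition calderon_norm :: "(complex \<Rightarrow> cseq) \<Rightarrow> real" where
  "calderon_norm F =
     max (SUP t. norm_inf (F (Complex 0 t))) (SUP t. norm_1 (F (Complex 1 t)))"

definition Delta :: "nat \<Rightarrow> (complex \<Rightarrow> cseq) \<Rightarrow> cseq" where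
  "Delta k F = (\<lambda>n. (Sigma_deriv ^^ k) F (1/2) n / fact k)"

definition ker_Delta :: "nat \<Rightarrow> (complex \<Rightarrow> cseq) set" where
  "ker_Delta k = {F \<in> calderon. Delta k F = (\<lambda>n. 0)}"

definition quotient_norm ::
    "((complex \<Rightarrow> cseq) \<Rightarrow> cseq) \<Rightarrow> (complex \<Rightarrow> cseq) set \<Rightarrow> cseq \<Rightarrow> real" where
  "quotient_norm T K x = Inf {calderon_norm F | F. F \<in> K \<and> T F = x}"

section \<open>Orlicz sequence spaces\<close>

definition orlicz_function :: "(real \<Rightarrow> real) \<Rightarrow> bool" where
  "orlicz_function M \<longleftrightarrow>
     continuous_on {0..} M \<and> convex_on {0..} M \<and> mono_on {0..} M \<and>
     M 0 = 0 \<and> filterlim M at_top at_top"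

definition orlicz_space :: "(real \<Rightarrow> real) \<Rightarrow> cseq set" where
  "orlicz_space M = {x. \<exists>\<rho>>0. summable (\<lambda>n. M (cmod (x n) / \<rho>))}"

text \<open>The Luxemburg norm.\<close>

definition orlicz_norm :: "(real \<Rightarrow> real) \<Rightarrow> cseq \<Rightarrow> real" where
  "orlicz_norm M x =
     Inf {\<rho>. \<rho> > 0 \<and> summable (\<lambda>n. M (cmod (x n) / \<rho>)) \<and> (\<Sum>n. M (cmod (x n) / \<rho>)) \<le> 1}"

definition equal_with_equivalent_norms ::
    "cseq set \<Rightarrow> (cseq \<Rightarrow> real) \<Rightarrow> cseq set \<Rightarrow> (cseq \<Rightarrow> real) \<Rightarrow> bool" where
  "equal_with_equivalent_norms X N Y M \<longleftrightarrow> X = Y \<and>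
     (\<exists>c>0. \<exists>C>0. \<forall>x\<in>X. c * M x \<le> N x \<and> N x \<le> C * M x)"

text \<open>The explicit description of the Orlicz spaces involved: the case \<open>k = 1\<close> is
  $t^2\log^2 t$ and \<open>k = 2\<close> is $t^2\log^4 t$. Since \<open>ln 0 = 0\<close>, the convention
  $0\log^k 0 = 0$ is built in.\<close>

lemma orlicz_space_log:
  assumes M: "orlicz_function M"
    and near0: "\<forall>\<^sub>F t in at_right 0. M t = t\<^sup>2 * ln t ^ (2 * k)"
  shows "orlicz_space M =
    {x. x \<in> ell_2 \<and> (\<lambda>n. x n * of_real (ln (cmod (x n)) ^ k)) \<in> ell_2}"
proof -
  obtain d where d: "d > 0" "\<And>t. 0 < t \<Longrightarrow> t < d \<Longrightarrow> M t = t\<^sup>2 * ln t ^ (2 * k)"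
    using near0 unfolding eventually_at_right_field by auto
  have M0: "M 0 = 0" and mono: "mono_on {0..} M"
    using M by (auto simp: orlicz_function_def)
  have d': "M t = t\<^sup>2 * ln t ^ (2 * k)" if "0 \<le> t" "t < d" for t
    using d that M0 by (cases "t = 0") auto
  have sq: "(cmod (x n * of_real (ln (cmod (x n)) ^ k)))\<^sup>2
      = (cmod (x n))\<^sup>2 * ln (cmod (x n)) ^ (2 * k)" for x :: cseq and n
    by (simp add: norm_mult norm_power power_mult_distrib mult.commute flip: power_mult)
      (simp add: power_mult[of _ 2] power2_abs mult.commute power_even_abs)
  show ?thesis
  proof (intro equalityI subsetI)
    fix x assume x: "x \<in> {x. x \<in> ell_2 \<and> (\<lambda>n. x n * of_real (ln (cmod (x n)) ^ k)) \<in> ell_2}"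
    then have "(\<lambda>n. (cmod (x n))\<^sup>2) \<longlonglongrightarrow> 0"
      by (intro summable_LIMSEQ_zero) (simp add: ell_2_def)
    then have "(\<lambda>n. cmod (x n)) \<longlonglongrightarrow> 0"
      using tendsto_real_sqrt[of "\<lambda>n. (cmod (x n))\<^sup>2" 0] by simp
    then have "\<forall>\<^sub>F n in sequentially. cmod (x n) < d"
      using d(1) order_tendstoD(2) by blast
    then have "\<forall>\<^sub>F n in sequentially.
        M (cmod (x n) / 1) = (cmod (x n * of_real (ln (cmod (x n)) ^ k)))\<^sup>2"
      by eventually_elim (simp only: sq, simp add: d')
    then have "summable (\<lambda>n. M (cmod (x n) / 1))"
      using x summable_cong by (fastforce simp: ell_2_def)
    then show "x \<in> orlicz_space M"
      unfolding orlicz_space_def using zero_less_one by blast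
  next
    fix x assume "x \<in> orlicz_space M"
    then obtain r where r: "r > 0" "summable (\<lambda>n. M (cmod (x n) / r))"
      unfolding orlicz_space_def by auto
    define y where "y n = cmod (x n) / r" for n
    define e where "e = min (d / 2) (exp (-1))"
    have e: "0 < e" "e < d" "e \<le> exp (-1)" using d(1) by (auto simp: e_def)
    have ln1: "1 \<le> \<bar>ln t\<bar>" if "0 < t" "t \<le> e" for t
    proof -
      have "t \<le> exp (-1)" using that e by simp
      then have "ln t \<le> -1" using that by (metis ln_exp ln_le_cancel_iff exp_gt_zero)
      then show ?thesis by simp
    qed
    have ge: "t\<^sup>2 \<le> M t" if "0 \<le> t" "t \<le> e" for t
    proof (cases "t = 0")
      case False
      then have "1 \<le> \<bar>ln t\<bar> ^ (2 * k)" using ln1 that by (intro one_le_power) auto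
      then have "1 \<le> ln t ^ (2 * k)" by (simp add: power_even_abs)
      then have "t\<^sup>2 * 1 \<le> t\<^sup>2 * ln t ^ (2 * k)" by (intro mult_left_mono) auto
      then show ?thesis using d'[of t] that e by simp
    qed (simp add: M0)
    have Me: "M e > 0" using ge[of e] e(1) by (smt (verit) zero_less_power)
    have y0: "y n \<ge> 0" for n using r(1) by (simp add: y_def)
    have sy: "summable (\<lambda>n. M (y n))" using r(2) by (simp add: y_def)
    then have "(\<lambda>n. M (y n)) \<longlonglongrightarrow> 0" by (rule summable_LIMSEQ_zero)
    then have "\<forall>\<^sub>F n in sequentially. M (y n) < M e" using Me order_tendstoD(2) by blast
    then have ev: "\<forall>\<^sub>F n in sequentially. y n \<le> e"
    proof eventually_elim
      case (elim n)
      show ?case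
      proof (rule ccontr)
        assume "\<not> y n \<le> e"
        then have "M e \<le> M (y n)" using mono e(1) y0[of n] by (auto simp: mono_on_def)
        with elim show False by simp
      qed
    qed
    have xy: "cmod (x n) = r * y n" for n using r(1) by (simp add: y_def)
    have "summable (\<lambda>n. (cmod (x n))\<^sup>2)"
    proof (rule summable_comparison_test_ev)
      show "summable (\<lambda>n. r\<^sup>2 * M (y n))" using sy by (rule summable_mult)
      show "\<forall>\<^sub>F n in sequentially. norm ((cmod (x n))\<^sup>2) \<le> r\<^sup>2 * M (y n)"
        using ev by eventually_elim (simp add: xy power_mult_distrib ge y0 mult_left_mono)
    qed
    moreover have "summable (\<lambda>n. (cmod (x n * of_real (ln (cmod (x n)) ^ k)))\<^sup>2)"
    proof (rule summable_comparison_test_ev)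
      let ?A = "r\<^sup>2 * (1 + \<bar>ln r\<bar>) ^ (2 * k)"
      show "summable (\<lambda>n. ?A * M (y n))" using sy by (rule summable_mult)
      show "\<forall>\<^sub>F n in sequentially.
          norm ((cmod (x n * of_real (ln (cmod (x n)) ^ k)))\<^sup>2) \<le> ?A * M (y n)"
        using ev
      proof eventually_elim
        case (elim n)
        show ?case
        proof (cases "y n = 0")
          case True
          then show ?thesis using M0 by (simp add: xy norm_mult)
        next
          case False
          then have y: "0 < y n" "y n \<le> e" using y0[of n] elim by auto
          have "ln (r * y n) = ln r + ln (y n)" using r(1) y by (simp add: ln_mult)
          also have "\<bar>\<dots>\<bar> \<le> \<bar>ln r\<bar> * 1 + \<bar>ln (y n)\<bar>" by linarith
          also have "\<dots> \<le> \<bar>ln r\<bar> * \<bar>ln (y n)\<bar> + \<bar>ln (y n)\<bar>"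
            using ln1[OF y] by (intro add_right_mono mult_left_mono) auto
          also have "\<dots> = (1 + \<bar>ln r\<bar>) * \<bar>ln (y n)\<bar>" by (simp add: algebra_simps)
          finally have "\<bar>ln (r * y n)\<bar> ^ (2 * k) \<le> ((1 + \<bar>ln r\<bar>) * \<bar>ln (y n)\<bar>) ^ (2 * k)"
            by (intro power_mono) auto
          then have "ln (r * y n) ^ (2 * k) \<le> (1 + \<bar>ln r\<bar>) ^ (2 * k) * ln (y n) ^ (2 * k)"
            by (simp add: power_even_abs power_mult_distrib)
          then have "(r * y n)\<^sup>2 * ln (r * y n) ^ (2 * k)
              \<le> (r * y n)\<^sup>2 * ((1 + \<bar>ln r\<bar>) ^ (2 * k) * ln (y n) ^ (2 * k))"
            by (intro mult_left_mono) auto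
          also have "\<dots> = ?A * M (y n)"
            using d'[of "y n"] y e by (simp add: power_mult_distrib)
          finally show ?thesis using sq[of x n] by (simp add: xy)
        qed
      qed
    qed
    ultimately show "x \<in> {x. x \<in> ell_2 \<and> (\<lambda>n. x n * of_real (ln (cmod (x n)) ^ k)) \<in> ell_2}"
      by (simp add: ell_2_def)
  qed
qed

end

theory Submission
  imports Defs "HOL-Complex_Analysis.Complex_Analysis" "HOL-Real_Asymp.Real_Asymp"
begin

text \<open>Since $\ell_1 \subseteq \ell_\infty$, the sum space is $\ell_\infty$ and everything reduces to
  estimates for single coordinates. If a coordinate \<open>f\<close> is bounded by $1$ on the left line and \<open>m\<close> is
  (an upper bound for) the mean of $|f|$ over the right line, then $f(z) m^{-z}$ is bounded near $1/2$ by
  Cauchy's formula; when the derivatives of \<open>f\<close> of orders $1,\dots,k$ vanish at $1/2$, the \<open>k\<close>-th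
  Taylor coefficient of this product is $f(1/2) m^{-1/2} (-\log m)^k / k!$, so
  $|f(1/2)| \, |\log m|^k = O(\sqrt m)$, and the means \<open>m\<close> of the coordinates are summable.
  Conversely, with $w = z - 1/2$, the functions $x_n e^{cw} \sum_{j\le k} (-cw)^j/j!$, damped by a
  cutoff flat to order \<open>k\<close> at \<open>w = 0\<close>, have the value $x_n$ and vanishing derivatives at $1/2$;
  the choice $c = 2\log(|x_n| |\log |x_n||^k)$, slightly perturbed, balances the two boundary lines.\<close>

section \<open>A pointwise bound from boundary means\<close>

text \<open>The norm on the right line bounds, for each t separately, a sum over the coordinates;
  the suprema over t of the single coordinates need not be summable. Averages against one fixed
  weight are, by exchanging sum and integral, so the scalar estimate has to start from a mean.
  Cauchy's formula with the extra denominator 1 - (z - 1/2)^2, whose zeros lie outside the strip,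
  puts the integrable weight 1/(1 + t^2) in place of the Poisson kernel. In the converse direction
  the obstacle is norm continuity: with exact balance the coordinates stay of comparable size on the
  left line while the frequencies |c| grow without bound, so the path into l_infinity would in
  general be discontinuous. Hence the n-th coordinate gets size s_n -> 0 on the left line and L_n^2
  / s_n on the right one, with L_n = t_n |log t_n|^k and t_n the rescaled |x_n|. The sum of L_n^2 is
  a modular of x, and dividing a convergent series by the square roots of its tails keeps it
  convergent. The factor |log t_n|^k is the price of the Taylor polynomial, which grows like
  |c|^k.\<close>

lemma integral_inverse_1_plus_square_le_pi:
  assumes "0 \<le> T"
  shows "(\<lambda>t::real. 1 / (1 + t\<^sup>2)) integrable_on {-T..T}"
    and "integral {-T..T} (\<lambda>t::real. 1 / (1 + t\<^sup>2)) \<le> pi"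
proof -
  have I: "((\<lambda>t::real. 1 / (1 + t\<^sup>2)) has_integral (arctan T - arctan (-T))) {-T..T}"
  proof (rule fundamental_theorem_of_calculus)
    show "(arctan has_vector_derivative 1 / (1 + t\<^sup>2)) (at t within {-T..T})" for t
      using DERIV_arctan[of t] unfolding has_real_derivative_iff_has_vector_derivative[symmetric]
      by (simp add: field_simps has_field_derivative_at_within)
  qed (use assms in auto)
  then show "(\<lambda>t::real. 1 / (1 + t\<^sup>2)) integrable_on {-T..T}" by blast
  show "integral {-T..T} (\<lambda>t::real. 1 / (1 + t\<^sup>2)) \<le> pi"
    using integral_unique[OF I] arctan_ubound[of T] by (simp add: arctan_minus)
qed

text \<open>Already the real part is that large, since |Re z - 1/2| is at most 1/2.\<close>

lemma strip_kernel_bound: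
  assumes "z \<in> strip"
  shows "3/4 * (1 + (Im z)\<^sup>2) \<le> cmod (1 - (z - 1/2)\<^sup>2)"
proof -
  have "(Re z - 1/2)\<^sup>2 \<le> (1/2)\<^sup>2"
    using assms by (intro abs_le_square_iff[THEN iffD1]) (auto simp: strip_def abs_le_iff field_simps)
  moreover have "Re (1 - (z - 1/2)\<^sup>2) = 1 - (Re z - 1/2)\<^sup>2 + (Im z)\<^sup>2"
    by (simp add: power2_eq_square)
  moreover have "Re (1 - (z - 1/2)\<^sup>2) \<le> cmod (1 - (z - 1/2)\<^sup>2)" by (rule complex_Re_le_cmod)
  ultimately show ?thesis by (simp add: power2_eq_square) (smt (verit) zero_le_square)
qed

lemma open_open_strip: "open open_strip"
proof -
  have "open ({z. 0 < Re z} \<inter> {z. Re z < 1})"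
    by (intro open_Int open_halfspace_Re_gt open_halfspace_Re_lt)
  then show ?thesis by (simp add: open_strip_def Collect_conj_eq)
qed

text \<open>After division by m^z the left line contributes at most the integral of 1/(1 + t^2), and
  the right line the mean divided by \<open>m\<close>, hence at most 1. The bound \<open>B\<close>
  enters only through the horizontal sides, which disappear in the limit, so 5 depends on neither
  \<open>B\<close> nor \<open>m\<close>.\<close>

lemma strip_pointwise_bound:
  fixes f :: "complex \<Rightarrow> complex"
  assumes cont: "continuous_on strip f" and hol: "f holomorphic_on open_strip"
    and B: "\<And>z. z \<in> strip \<Longrightarrow> cmod (f z) \<le> B"
    and left: "\<And>t. cmod (f (Complex 0 t)) \<le> 1"
    and right: "\<And>N::nat. integral {-real N..real N} (\<lambda>t. cmod (f (Complex 1 t)) / (1 + t\<^sup>2)) \<le> m"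
    and m: "0 < m" and z: "cmod (z - 1/2) \<le> 1/4"
  shows "cmod (f z * exp (- (of_real (ln m) * z))) \<le> 5"
proof -
  define q where "q w = 1 - (w - 1/2)\<^sup>2" for w :: complex
  define G where "G w = f w * exp (- (of_real (ln m) * w)) / q w" for w
  define H where "H w = G w / (w - z)" for w
  have rez: "1/4 \<le> Re z" "Re z \<le> 3/4" and imz: "\<bar>Im z\<bar> \<le> 1/4"
    using z abs_Re_le_cmod[of "z - 1/2"] abs_Im_le_cmod[of "z - 1/2"] by (auto simp: abs_le_iff)
  have q_ge: "3/4 * (1 + (Im w)\<^sup>2) \<le> cmod (q w)" if "w \<in> strip" for w
    using strip_kernel_bound[OF that] by (simp add: q_def)
  have q0: "q w \<noteq> 0" if "w \<in> strip" for w
    using q_ge[OF that] zero_le_power2[of "Im w"] by (smt (verit) norm_zero mult_pos_pos zero_less_divide_iff)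
  have sub: "open_strip \<subseteq> strip" by (auto simp: strip_def open_strip_def)
  have contG: "continuous_on strip G"
    unfolding G_def using q0 by (auto intro!: continuous_intros cont simp: q_def)
  have holG: "G holomorphic_on open_strip"
    unfolding G_def using q0 sub by (auto intro!: holomorphic_intros hol simp: q_def)
  \<comment> \<open>16/3 is the reciprocal of 3/4 * 1/4: the lower bound for \<open>q\<close> times
    the distance from \<open>z\<close> to the sides of the rectangle.\<close>
  have Hb: "cmod (H w) \<le> 16/3 * (cmod (f w) * exp (- (ln m * Re w))) / (1 + (Im w)\<^sup>2)"
    if w: "w \<in> strip" and d: "1/4 \<le> cmod (w - z)" for w
  proof -
    have p: "0 < 1 + (Im w)\<^sup>2" by (simp add: add_pos_nonneg)
    have "cmod (H w) = (cmod (f w) * exp (- (ln m * Re w))) / (cmod (q w) * cmod (w - z))"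
      by (simp add: H_def G_def norm_mult norm_divide)
    also have "\<dots> \<le> (cmod (f w) * exp (- (ln m * Re w))) / ((3/4 * (1 + (Im w)\<^sup>2)) * (1/4))"
      using p q_ge[OF w] d by (intro divide_left_mono mult_mono) (auto intro!: mult_pos_pos simp: q0[OF w] intro: less_le_trans)
    finally show ?thesis by (simp add: field_simps)
  qed
  define E where "E = B * exp \<bar>ln m\<bar>"
  have B0: "0 \<le> B" using B[of 0] norm_ge_zero[of "f 0"] by (simp add: strip_def del: norm_ge_zero)
  have E0: "0 \<le> E" using B0 by (simp add: E_def)
  have main: "2 * pi * cmod (G z) \<le> 16/3 * (1 + pi) + 2 * (16/3 * E / (1 + (real N)\<^sup>2))"
    if N: "1 \<le> N" for N :: nat
  proof -
    define T where "T = real N"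
    have T: "1 \<le> T" using N by (simp add: T_def)
    define a b where "a = Complex 0 (-T)" and "b = Complex 1 T"
    define c d where "c = Complex 1 (-T)" and "d = Complex 0 T"
    have pimg: "path_image (rectpath a b) = cbox a b - box a b"
      using T by (intro path_image_rectpath_cbox_minus_box) (auto simp: a_def b_def)
    have zbox: "z \<in> box a b"
      using rez imz T by (auto simp: in_box_complex_iff a_def b_def abs_le_iff)
    have cb: "cbox a b \<subseteq> strip" by (auto simp: in_cbox_complex_iff a_def b_def strip_def)
    have bx: "box a b \<subseteq> open_strip" by (auto simp: in_box_complex_iff a_def b_def open_strip_def)
    have rp: "rectpath a b = linepath a c +++ linepath c b +++ linepath b d +++ linepath d a"
      by (simp add: rectpath_def Let_def a_def b_def c_def d_def)
    have "(H has_contour_integral (2 * pi * \<i> * winding_number (rectpath a b) z * G z)) (rectpath a b)"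
      unfolding H_def
    \<comment> \<open>The vertical sides lie on the boundary of the strip, where only continuity is
      available; the weak form of the formula asks for no more.\<close>
    proof (rule Cauchy_integral_formula_weak[where k = "{}" and S = "cbox a b"])
      show "continuous_on (cbox a b) G" using contG cb continuous_on_subset by blast
      show "G field_differentiable at x" if "x \<in> interior (cbox a b) - {}" for x
      proof -
        have "x \<in> open_strip" using that bx by (auto simp: interior_cbox)
        then show ?thesis using holG open_open_strip holomorphic_on_imp_differentiable_at by blast
      qed
      show "path_image (rectpath a b) \<subseteq> cbox a b - {z}" using pimg zbox by auto
    qed (use zbox in \<open>auto simp: interior_cbox convex_box\<close>)
    then have CI: "(H has_contour_integral (2 * pi * \<i> * G z)) (rectpath a b)"
      by (simp add: winding_number_rectpath[OF zbox])
    have segs: "closed_segment a c \<subseteq> path_image (rectpath a b)"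
      "closed_segment c b \<subseteq> path_image (rectpath a b)"
      "closed_segment b d \<subseteq> path_image (rectpath a b)"
      "closed_segment d a \<subseteq> path_image (rectpath a b)"
      by (auto simp: rp path_image_join)
    have contH: "continuous_on (path_image (rectpath a b)) H"
      unfolding H_def using pimg zbox cb
      by (intro continuous_intros continuous_on_subset[OF contG]) auto
    have ints: "H contour_integrable_on linepath a c" "H contour_integrable_on linepath c b"
      "H contour_integrable_on linepath b d" "H contour_integrable_on linepath d a"
      using segs contH continuous_on_subset by (blast intro: contour_integrable_continuous_linepath)+
    let ?I = "\<lambda>u v. contour_integral (linepath u v) H"
    have "2 * pi * \<i> * G z = contour_integral (rectpath a b) H"
      using contour_integral_unique[OF CI] by simp
    also have "\<dots> = ?I a c + (?I c b + (?I b d + ?I d a))"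
      unfolding rp using ints by simp
    finally have dec: "2 * pi * \<i> * G z = ?I a c + (?I c b + (?I b d + ?I d a))" .
    have far: "1/4 \<le> cmod (w - z)" if "Re w = 0 \<or> Re w = 1 \<or> \<bar>Im w\<bar> = T" for w
      using that rez imz T abs_Re_le_cmod[of "w - z"] abs_Im_le_cmod[of "w - z"] by auto
    have horb: "cmod (H w) \<le> 16/3 * E / (1 + T\<^sup>2)" if "w \<in> strip" "\<bar>Im w\<bar> = T" for w
    proof -
      have "- (ln m * Re w) \<le> \<bar>ln m\<bar> * \<bar>Re w\<bar>" by (metis abs_ge_minus_self abs_mult)
      also have "\<dots> \<le> \<bar>ln m\<bar> * 1" using that by (intro mult_left_mono) (auto simp: strip_def)
      finally have "cmod (f w) * exp (- (ln m * Re w)) \<le> E"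
        unfolding E_def using B[OF that(1)] B0 by (intro mult_mono) auto
      moreover have "(Im w)\<^sup>2 = T\<^sup>2" using that(2) by (metis power2_abs)
      ultimately show ?thesis
        using Hb[OF that(1) far] that(2)
        by (intro order_trans[OF Hb[OF that(1) far]]) (auto intro!: divide_right_mono)
    qed
    have E1: "0 \<le> 16/3 * E / (1 + T\<^sup>2)" using E0 by auto
    have "cmod (?I a c) \<le> 16/3 * E / (1 + T\<^sup>2) * cmod (c - a)"
      using ints(1) E1
      by (rule contour_integral_bound_linepath)
         (rule horb, use T in \<open>auto simp: a_def c_def closed_segment_same_Im closed_segment_eq_real_ivl strip_def\<close>)
    then have h1: "cmod (?I a c) \<le> 16/3 * E / (1 + T\<^sup>2)"
      by (simp add: a_def c_def complex_diff cmod_def)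
    have "cmod (?I b d) \<le> 16/3 * E / (1 + T\<^sup>2) * cmod (d - b)"
      using ints(3) E1
      by (rule contour_integral_bound_linepath)
         (rule horb, use T in \<open>auto simp: b_def d_def closed_segment_same_Im closed_segment_eq_real_ivl strip_def\<close>)
    then have h2: "cmod (?I b d) \<le> 16/3 * E / (1 + T\<^sup>2)"
      by (simp add: b_def d_def complex_diff cmod_def)
    have contv: "continuous_on {-T..T} (\<lambda>t. g (Complex x t))"
      if "continuous_on strip g" "x = 0 \<or> x = 1" for x and g :: "complex \<Rightarrow> complex"
    proof -
      have "continuous_on {-T..T} (g \<circ> Complex x)"
        using that by (intro continuous_on_compose continuous_on_subset[OF that(1)])
          (auto intro!: continuous_intros simp: strip_def)
      then show ?thesis by (simp add: o_def)
    qed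
    have v1: "cmod (?I c b) \<le> 16/3"
    proof -
      have "?I c b = \<i> * integral {-T..T} (\<lambda>t. H (Complex 1 t))"
        by (rule contour_integral_linepath_same_Re) (use T in \<open>auto simp: b_def c_def\<close>)
      then have "cmod (?I c b) = cmod (integral {-T..T} (\<lambda>t. H (Complex 1 t)))"
        by (simp add: norm_mult)
      also have "\<dots> \<le> integral {-T..T} (\<lambda>t. 16/3 / m * (cmod (f (Complex 1 t)) / (1 + t\<^sup>2)))"
      proof (rule integral_norm_bound_integral)
        show "(\<lambda>t. H (Complex 1 t)) integrable_on {-T..T}"
          unfolding H_def using rez
          by (intro integrable_continuous_real continuous_intros contv contG) (auto simp: complex_eq_iff)
        show "(\<lambda>t. 16/3 / m * (cmod (f (Complex 1 t)) / (1 + t\<^sup>2))) integrable_on {-T..T}"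
          by (intro integrable_continuous_real continuous_intros contv cont)
             (auto simp: add_nonneg_eq_0_iff)
        show "cmod (H (Complex 1 t)) \<le> 16/3 / m * (cmod (f (Complex 1 t)) / (1 + t\<^sup>2))" for t
          using Hb[of "Complex 1 t"] far[of "Complex 1 t"] m
          by (simp add: strip_def exp_minus field_simps)
      qed
      also have "\<dots> = 16/3 / m * integral {-T..T} (\<lambda>t. cmod (f (Complex 1 t)) / (1 + t\<^sup>2))"
        by (rule integral_mult_right)
      also have "\<dots> \<le> 16/3 / m * m"
        using right[of N] m by (intro mult_left_mono) (auto simp: T_def)
      finally show ?thesis using m by simp
    qed
    have v2: "cmod (?I d a) \<le> 16/3 * pi"
    proof -
      have "?I a d = \<i> * integral {-T..T} (\<lambda>t. H (Complex 0 t))"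
        by (rule contour_integral_linepath_same_Re) (use T in \<open>auto simp: a_def d_def\<close>)
      then have "cmod (?I d a) = cmod (integral {-T..T} (\<lambda>t. H (Complex 0 t)))"
        using contour_integral_reverse_linepath[of a d H] ints(4) contH segs(4)
        by (metis closed_segment_commute continuous_on_subset norm_ii norm_minus_cancel norm_mult mult_1)
      also have "\<dots> \<le> integral {-T..T} (\<lambda>t. 16/3 * (1 / (1 + t\<^sup>2)))"
      proof (rule integral_norm_bound_integral)
        show "(\<lambda>t. H (Complex 0 t)) integrable_on {-T..T}"
          unfolding H_def using rez
          by (intro integrable_continuous_real continuous_intros contv contG) (auto simp: complex_eq_iff)
        show "(\<lambda>t. 16/3 * (1 / (1 + t\<^sup>2))) integrable_on {-T..T}"
          by (intro integrable_continuous_real continuous_intros) (auto simp: add_nonneg_eq_0_iff)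
        show "cmod (H (Complex 0 t)) \<le> 16/3 * (1 / (1 + t\<^sup>2))" for t
        proof -
          have "cmod (H (Complex 0 t)) \<le> 16/3 * cmod (f (Complex 0 t)) / (1 + t\<^sup>2)"
            using Hb[of "Complex 0 t"] far[of "Complex 0 t"] by (simp add: strip_def)
          also have "\<dots> \<le> 16/3 * 1 / (1 + t\<^sup>2)"
            using left[of t] by (intro divide_right_mono mult_left_mono) auto
          finally show ?thesis by simp
        qed
      qed
      also have "\<dots> = 16/3 * integral {-T..T} (\<lambda>t. 1 / (1 + t\<^sup>2))" by (rule integral_mult_right)
      also have "\<dots> \<le> 16/3 * pi"
        using integral_inverse_1_plus_square_le_pi(2)[of T] T by (intro mult_left_mono) auto
      finally show ?thesis .
    qed
    have "2 * pi * cmod (G z) = cmod (2 * pi * \<i> * G z)" by (simp add: norm_mult)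
    also have "\<dots> \<le> cmod (?I a c) + (cmod (?I c b) + (cmod (?I b d) + cmod (?I d a)))"
      unfolding dec by (intro order_trans[OF norm_triangle_ineq] add_mono order_refl)
    finally show ?thesis using h1 h2 v1 v2 unfolding T_def[symmetric] distrib_left by linarith
  qed
  have "2 * pi * cmod (G z) \<le> 16/3 * (1 + pi)"
  proof (rule LIMSEQ_le_const)
    have "(\<lambda>N. 1 / (1 + (real N)\<^sup>2)) \<longlonglongrightarrow> 0" by real_asymp
    then have "(\<lambda>N. 16/3 * (1 + pi) + 2 * (16/3 * E) * (1 / (1 + (real N)\<^sup>2)))
        \<longlonglongrightarrow> 16/3 * (1 + pi) + 2 * (16/3 * E) * 0"
      by (intro tendsto_intros)
    then show "(\<lambda>N. 16/3 * (1 + pi) + 2 * (16/3 * E / (1 + (real N)\<^sup>2))) \<longlonglongrightarrow> 16/3 * (1 + pi)"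
      by simp
    show "\<exists>N. \<forall>n\<ge>N. 2 * pi * cmod (G z) \<le> 16/3 * (1 + pi) + 2 * (16/3 * E / (1 + (real n)\<^sup>2))"
      using main by blast
  qed
  then have "cmod (G z) \<le> 8/3 * (1 + 1 / pi)" by (simp add: field_simps)
  also have "\<dots> \<le> 8/3 * (1 + 1/3)" using pi_gt3 by (intro mult_left_mono add_left_mono) (auto simp: field_simps)
  finally have Gz: "cmod (G z) \<le> 32/9" by simp
  \<comment> \<open>Undoing the division by \<open>q\<close> costs a factor of at most 17/16, and
    32/9 * 17/16 = 34/9 is rounded up to 5.\<close>
  have "cmod (q z) \<le> 1 + cmod (z - 1/2) ^ 2"
    unfolding q_def using norm_triangle_ineq4[of 1 "(z - 1/2)\<^sup>2"] by (simp add: norm_power)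
  also have "\<dots> \<le> 1 + (1/4)\<^sup>2" using z by (intro add_left_mono power_mono) auto
  finally have "cmod (G z) * cmod (q z) \<le> 32/9 * (1 + (1/4)\<^sup>2)"
    using Gz by (intro mult_mono) auto
  moreover have "q z \<noteq> 0" using rez by (intro q0) (auto simp: strip_def)
  then have "f z * exp (- (of_real (ln m) * z)) = G z * q z" by (simp add: G_def)
  then have "cmod (f z * exp (- (of_real (ln m) * z))) = cmod (G z) * cmod (q z)"
    by (simp add: norm_mult)
  ultimately show ?thesis by (simp add: power2_eq_square)
qed

lemma higher_deriv_exp_linear: "(deriv ^^ n) (\<lambda>z. exp (c * z)) = (\<lambda>z. c ^ n * exp (c * z))" for c :: complex
proof (induction n)
  case (Suc n)
  have "deriv (\<lambda>z. c ^ n * exp (c * z)) z = c ^ Suc n * exp (c * z)" for z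
    by (rule DERIV_imp_deriv) (auto intro!: derivative_eq_intros)
  then show ?case using Suc by auto
qed auto

text \<open>Flatness leaves a single term in the Leibniz rule, the one in which all \<open>k\<close>
  derivatives fall on the exponential; 4^k comes from the radius 1/4 of the disc on which the bound
  5 holds. For \<open>k = 0\<close> the flatness condition is empty and a plain bound by sqrt m
  remains.\<close>

lemma flat_centre_bound:
  fixes f :: "complex \<Rightarrow> complex"
  assumes cont: "continuous_on strip f" and hol: "f holomorphic_on open_strip"
    and B: "\<And>z. z \<in> strip \<Longrightarrow> cmod (f z) \<le> B"
    and left: "\<And>t. cmod (f (Complex 0 t)) \<le> 1"
    and right: "\<And>N::nat. integral {-real N..real N} (\<lambda>t. cmod (f (Complex 1 t)) / (1 + t\<^sup>2)) \<le> m"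
    and m: "0 < m" and flat: "\<And>j. 1 \<le> j \<Longrightarrow> j \<le> k \<Longrightarrow> (deriv ^^ j) f (1/2) = 0"
  shows "cmod (f (1/2)) * \<bar>ln m\<bar> ^ k \<le> 5 * fact k * 4 ^ k * sqrt m"
proof -
  define c where "c = - complex_of_real (ln m)"
  define h where "h z = f z * exp (c * z)" for z
  have sub: "cball (1/2) (1/4) \<subseteq> open_strip"
  proof
    fix z :: complex assume "z \<in> cball (1/2) (1/4)"
    then have "\<bar>Re (z - 1/2)\<bar> \<le> 1/4"
      using abs_Re_le_cmod[of "z - 1/2"] by (simp add: dist_norm norm_minus_commute)
    then show "z \<in> open_strip" by (auto simp: open_strip_def abs_if split: if_splits)
  qed
  have half: "1/2 \<in> open_strip" by (simp add: open_strip_def)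
  have holh: "h holomorphic_on open_strip" unfolding h_def by (intro holomorphic_intros hol)
  have "cmod ((deriv ^^ k) h (1/2)) \<le> fact k * 5 / (1/4) ^ k"
  proof (rule Cauchy_inequality)
    show "h holomorphic_on ball (1/2) (1/4)"
      using holh sub by (meson ball_subset_cball holomorphic_on_subset subset_trans)
    show "continuous_on (cball (1/2) (1/4)) h"
      using holh sub by (meson holomorphic_on_imp_continuous_on holomorphic_on_subset)
    show "cmod (h z) \<le> 5" if "cmod (1/2 - z) = 1/4" for z
      using strip_pointwise_bound[OF cont hol B left right m, of z] that
      by (simp add: h_def c_def norm_minus_commute)
  qed auto
  moreover have "(deriv ^^ k) h (1/2) = f (1/2) * (c ^ k * exp (c / 2))"
  proof -
    have "(deriv ^^ k) h (1/2) = (\<Sum>i = 0..k. of_nat (k choose i) * (deriv ^^ i) f (1/2)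
        * (deriv ^^ (k - i)) (\<lambda>z. exp (c * z)) (1/2))"
      unfolding h_def
      by (rule higher_deriv_mult[OF hol _ open_open_strip half]) (intro holomorphic_intros)
    also have "\<dots> = (\<Sum>i = 0..k. if i = 0 then f (1/2) * (c ^ k * exp (c / 2)) else 0)"
      by (intro sum.cong) (auto simp: flat higher_deriv_exp_linear)
    finally show ?thesis by simp
  qed
  moreover have "cmod (exp (c / 2)) = 1 / sqrt m"
  proof -
    have "cmod (exp (c / 2)) = exp (- (ln m / 2))" by (simp add: c_def)
    also have "\<dots> = 1 / exp (ln m / 2)" by (simp add: exp_minus field_simps)
    also have "exp (ln m / 2) = sqrt m" using m by (simp add: ln_sqrt flip: ln_sqrt)
    finally show ?thesis .
  qed
  ultimately have "cmod (f (1/2)) * \<bar>ln m\<bar> ^ k / sqrt m \<le> fact k * 5 / (1/4) ^ k"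
    by (simp add: norm_mult norm_power c_def)
  then show ?thesis using m by (simp add: field_simps power_divide)
qed

section \<open>Coordinates of functions in the Calderon space\<close>

lemma ell_infI: "(\<And>n. cmod (x n) \<le> B) \<Longrightarrow> x \<in> ell_inf"
  by (auto simp: ell_inf_def bounded_iff)

lemma cmod_le_norm_inf: "x \<in> ell_inf \<Longrightarrow> cmod (x n) \<le> norm_inf x"
  unfolding norm_inf_def ell_inf_def
  by (intro cSUP_upper) (auto simp: bounded_iff bdd_above_def)

lemma norm_inf_le: "(\<And>n. cmod (x n) \<le> B) \<Longrightarrow> norm_inf x \<le> B"
  unfolding norm_inf_def by (intro cSUP_least) auto

lemma norm_inf_nonneg: "x \<in> ell_inf \<Longrightarrow> 0 \<le> norm_inf x"
  using cmod_le_norm_inf[of x 0] norm_ge_zero order_trans by blast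

lemma ell_inf_add: "x \<in> ell_inf \<Longrightarrow> y \<in> ell_inf \<Longrightarrow> (\<lambda>n. x n + y n) \<in> ell_inf"
  by (rule ell_infI[where B = "norm_inf x + norm_inf y"])
    (meson add_mono cmod_le_norm_inf norm_triangle_ineq order_trans)

lemma ell_inf_diff: "x \<in> ell_inf \<Longrightarrow> y \<in> ell_inf \<Longrightarrow> (\<lambda>n. x n - y n) \<in> ell_inf"
  by (rule ell_infI[where B = "norm_inf x + norm_inf y"])
    (meson add_mono cmod_le_norm_inf norm_triangle_ineq4 order_trans)

lemma ell_inf_divide: "x \<in> ell_inf \<Longrightarrow> (\<lambda>n. x n / c) \<in> ell_inf"
  by (rule ell_infI[where B = "norm_inf x / cmod c"])
    (simp add: norm_divide divide_right_mono cmod_le_norm_inf)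

lemma cmod_le_norm_1: "x \<in> ell_1 \<Longrightarrow> cmod (x n) \<le> norm_1 x"
  unfolding norm_1_def ell_1_def using sum_le_suminf[of "\<lambda>n. cmod (x n)" "{n}"] by auto

section \<open>The sum space is l_infinity with its own norm\<close>

lemma Sigma_space_eq: "Sigma_space = ell_inf"
proof
  show "Sigma_space \<subseteq> ell_inf"
  proof
    fix x assume "x \<in> Sigma_space"
    then obtain a b where "a \<in> ell_inf" "b \<in> ell_1" "x = (\<lambda>n. a n + b n)"
      by (auto simp: Sigma_space_def)
    moreover from \<open>b \<in> ell_1\<close> have "b \<in> ell_inf" using cmod_le_norm_1 ell_infI by blast
    ultimately show "x \<in> ell_inf" using ell_inf_add by blast
  qed
  have "x \<in> Sigma_space" if "x \<in> ell_inf" for x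
    unfolding Sigma_space_def using that
    by (intro CollectI exI[of _ x] exI[of _ "\<lambda>n. 0"]) (auto simp: ell_1_def)
  then show "ell_inf \<subseteq> Sigma_space" by blast
qed

text \<open>Since \<open>norm_1\<close> dominates the sup norm, splitting off a part in
  \<open>ell_1\<close> never helps, and x = x + 0 attains the infimum.\<close>

lemma Sigma_norm_eq:
  assumes x: "x \<in> ell_inf"
  shows "Sigma_norm x = norm_inf x"
  unfolding Sigma_norm_def
proof (rule cInf_eq_minimum)
  show "norm_inf x \<in> {norm_inf a + norm_1 b | a b. a \<in> ell_inf \<and> b \<in> ell_1 \<and> x = (\<lambda>n. a n + b n)}"
    using x by (intro CollectI exI[of _ x] exI[of _ "\<lambda>n. 0"]) (auto simp: ell_1_def norm_1_def)
next
  fix y assume "y \<in> {norm_inf a + norm_1 b | a b. a \<in> ell_inf \<and> b \<in> ell_1 \<and> x = (\<lambda>n. a n + b n)}"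
  then obtain a b where ab: "y = norm_inf a + norm_1 b" "a \<in> ell_inf" "b \<in> ell_1" "x = (\<lambda>n. a n + b n)"
    by blast
  show "norm_inf x \<le> y"
  proof (rule norm_inf_le)
    show "cmod (x n) \<le> y" for n
      using cmod_le_norm_inf[OF ab(2), of n] cmod_le_norm_1[OF ab(3), of n]
        norm_triangle_ineq[of "a n" "b n"] ab by simp
  qed
qed

section \<open>Derivatives in the sum space and derivatives of coordinates\<close>

lemma Sigma_has_deriv_coord:
  assumes U: "open U" "z \<in> U" and F: "\<And>w. w \<in> U \<Longrightarrow> F w \<in> ell_inf" and D: "Sigma_has_deriv F D z"
  shows "((\<lambda>w. F w n) has_field_derivative D n) (at z)"
proof -
  have Dinf: "D \<in> ell_inf" using D by (simp add: Sigma_has_deriv_def Sigma_space_eq)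
  let ?y = "\<lambda>h n. (F (z + h) n - F z n) / h - D n"
  \<comment> \<open>For an unbounded sequence \<open>Sigma_norm\<close> is the infimum of an empty
    set and says nothing about coordinates, so the difference quotients must first be known to be
    bounded sequences.\<close>
  have "eventually (\<lambda>h. z + h \<in> U) (at 0)"
  proof -
    have "((\<lambda>h. z + h) \<longlongrightarrow> z + 0) (at 0)" by (intro tendsto_intros)
    then show ?thesis using U by (auto dest: topological_tendstoD)
  qed
  then have "eventually (\<lambda>h. norm (?y h n) \<le> Sigma_norm (?y h)) (at 0)"
  proof eventually_elim
    case (elim h)
    have "?y h \<in> ell_inf"
      using F elim U Dinf by (intro ell_inf_diff ell_inf_divide) auto
    then show ?case using cmod_le_norm_inf[of "?y h" n] Sigma_norm_eq by simp
  qed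
  then have "((\<lambda>h. ?y h n) \<longlongrightarrow> 0) (at 0)"
    using D unfolding Sigma_has_deriv_def by (auto intro: Lim_null_comparison)
  then have "((\<lambda>h. (F (z + h) n - F z n) / h) \<longlongrightarrow> D n) (at 0)"
    by (simp add: LIM_zero_iff)
  then show ?thesis by (simp add: DERIV_def)
qed

text \<open>Uniqueness of complex derivatives, coordinate by coordinate, makes the description by
  \<open>THE\<close> meaningful.\<close>

lemma Sigma_deriv_eq:
  assumes U: "open U" "z \<in> U" and F: "\<And>w. w \<in> U \<Longrightarrow> F w \<in> ell_inf" and D: "Sigma_has_deriv F D z"
  shows "Sigma_deriv F z = D"
  unfolding Sigma_deriv_def
proof (rule the_equality)
  show "D' = D" if "Sigma_has_deriv F D' z" for D'
    using Sigma_has_deriv_coord[where F = F, OF U F D] Sigma_has_deriv_coord[where F = F, OF U F that] DERIV_unique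
    by blast
qed fact

text \<open>Uniform boundedness makes the difference quotients of all coordinates converge at a common
  rate, by Cauchy's estimate for the second derivative.\<close>

lemma Sigma_has_derivI:
  assumes U: "open U" "z \<in> U" and hol: "\<And>n. (\<lambda>w. F w n) holomorphic_on U"
    and B: "\<And>w n. w \<in> U \<Longrightarrow> cmod (F w n) \<le> B"
  shows "Sigma_has_deriv F (\<lambda>n. deriv (\<lambda>w. F w n) z) z"
proof -
  obtain R where R: "R > 0" "cball z R \<subseteq> U" using U open_contains_cball by blast
  \<comment> \<open>With half the radius, every point of \<open>cball z r\<close> is the centre of a
    disc of radius \<open>r\<close> inside \<open>U\<close>, so Cauchy's estimates hold there with
    one constant.\<close>
  define r where "r = R / 2"
  have r: "0 < r" using R by (simp add: r_def)
  have inU: "cball w r \<subseteq> U" if "w \<in> cball z r" for w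
  proof
    fix v assume "v \<in> cball w r"
    then have "dist z v \<le> r + r" using that dist_triangle[of z v w] by auto
    then show "v \<in> U" using R by (auto simp: r_def)
  qed
  have zU: "cball z r \<subseteq> U" using inU[of z] r by simp
  let ?f = "\<lambda>n w. F w n"
  have cauchy: "cmod ((deriv ^^ j) (?f n) w) \<le> fact j * B / r ^ j" if "w \<in> cball z r" for j n w
  proof (rule Cauchy_inequality)
    have h: "?f n holomorphic_on cball w r" using hol inU[OF that] holomorphic_on_subset by blast
    then show "?f n holomorphic_on ball w r" using ball_subset_cball holomorphic_on_subset by blast
    show "continuous_on (cball w r) (?f n)" using h by (rule holomorphic_on_imp_continuous_on)
    show "cmod (F x n) \<le> B" if "cmod (w - x) = r" for x
      using B inU[OF \<open>w \<in> cball z r\<close>] that by (auto simp: dist_norm)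
  qed fact
  \<comment> \<open>This bounds the second derivatives of all coordinates;
    \<open>complex_Taylor\<close> divides its remainder only by \<open>fact 1\<close>, so the 2
    stays.\<close>
  define K where "K = 2 * B / r ^ 2"
  have taylor: "cmod (F (z + h) n - F z n - deriv (?f n) z * h) \<le> K * cmod h ^ 2"
    if h: "cmod h \<le> r" for h n
  proof -
    have "cmod ((deriv ^^ 0) (?f n) (z + h) - (\<Sum>i\<le>1. (deriv ^^ i) (?f n) z * (z + h - z) ^ i / fact i))
        \<le> K * cmod (z + h - z) ^ Suc 1 / fact 1"
    proof (rule complex_Taylor)
      show "((deriv ^^ i) (?f n) has_field_derivative (deriv ^^ Suc i) (?f n) x) (at x within cball z r)"
        if "x \<in> cball z r" for i x
        using has_field_derivative_higher_deriv[OF hol U(1) subsetD[OF zU that]]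
        by (rule has_field_derivative_at_within)
      show "cmod ((deriv ^^ Suc 1) (?f n) x) \<le> K" if "x \<in> cball z r" for x
        using cauchy[OF that, of "Suc 1" n] by (simp add: K_def power2_eq_square)
    qed (use r h in \<open>auto simp: dist_norm\<close>)
    then show ?thesis by (simp add: power2_eq_square algebra_simps)
  qed
  define D where "D n = deriv (?f n) z" for n
  have Dinf: "D \<in> ell_inf"
    by (rule ell_infI[where B = "fact 1 * B / r ^ 1"]) (use cauchy[of z 1] r in \<open>simp add: D_def\<close>)
  let ?y = "\<lambda>h n. (F (z + h) n - F z n) / h - D n"
  have y: "cmod (?y h n) \<le> K * cmod h" if "h \<noteq> 0" "cmod h \<le> r" for h n
  proof -
    have "?y h n = (F (z + h) n - F z n - D n * h) / h" using that by (simp add: field_simps)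
    then have "cmod (?y h n) = cmod (F (z + h) n - F z n - D n * h) / cmod h" by (simp add: norm_divide)
    also have "\<dots> \<le> K * cmod h ^ 2 / cmod h"
      using taylor[OF that(2), of n] by (intro divide_right_mono) (auto simp: D_def)
    finally show ?thesis using that by (simp add: power2_eq_square)
  qed
  have "((\<lambda>h. Sigma_norm (?y h)) \<longlongrightarrow> 0) (at 0)"
  proof (rule tendsto_sandwich)
    have ev: "eventually (\<lambda>h. h \<noteq> 0 \<and> cmod h \<le> r) (at 0)"
      using r by (auto simp: eventually_at intro!: exI[of _ r])
    show "eventually (\<lambda>h. 0 \<le> Sigma_norm (?y h)) (at 0)"
      using ev
    proof eventually_elim
      case (elim h)
      then have "?y h \<in> ell_inf" by (intro ell_infI[where B = "K * cmod h"] y) auto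
      then show ?case using norm_inf_nonneg Sigma_norm_eq by simp
    qed
    show "eventually (\<lambda>h. Sigma_norm (?y h) \<le> K * cmod h) (at 0)"
      using ev
    proof eventually_elim
      case (elim h)
      then have "?y h \<in> ell_inf" by (intro ell_infI[where B = "K * cmod h"] y) auto
      then show ?case using norm_inf_le[of "?y h", OF y] elim Sigma_norm_eq by simp
    qed
    have "((\<lambda>h. K * cmod h) \<longlongrightarrow> K * cmod 0) (at 0)" by (intro tendsto_intros)
    then show "((\<lambda>h::complex. K * cmod h) \<longlongrightarrow> 0) (at 0)" by simp
  qed auto
  then show ?thesis using Dinf unfolding Sigma_has_deriv_def Sigma_space_eq D_def by blast
qed

text \<open>\<open>Sigma_has_derivI\<close> cannot be iterated on \<open>U\<close> itself, because
  derivatives of bounded functions may be unbounded near its boundary. Cauchy's estimate restores a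
  uniform bound on a small ball around each point, and differentiation is local.\<close>

lemma Sigma_higher_deriv:
  assumes U: "open U" "z \<in> U" and hol: "\<And>n. (\<lambda>w. F w n) holomorphic_on U"
    and B: "\<And>w n. w \<in> U \<Longrightarrow> cmod (F w n) \<le> B"
  shows "(Sigma_deriv ^^ j) F z = (\<lambda>n. (deriv ^^ j) (\<lambda>w. F w n) z)"
  using U(2)
proof (induction j arbitrary: z)
  case (Suc j)
  let ?G = "(Sigma_deriv ^^ j) F"
  obtain R where R: "R > 0" "cball z R \<subseteq> U" using U Suc.prems open_contains_cball by blast
  define r where "r = R / 2"
  have r: "0 < r" using R by (simp add: r_def)
  have inU: "cball w r \<subseteq> U" if "w \<in> ball z r" for w
  proof
    fix v assume "v \<in> cball w r"
    then have "dist z v \<le> r + r" using that dist_triangle[of z v w] by auto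
    then show "v \<in> U" using R by (auto simp: r_def)
  qed
  have sub: "ball z r \<subseteq> U" using R by (auto simp: r_def subset_iff)
  have G: "?G w n = (deriv ^^ j) (\<lambda>w. F w n) w" if "w \<in> U" for w n
    using Suc.IH[OF that] by simp
  have holG: "(\<lambda>w. ?G w n) holomorphic_on ball z r" for n
  proof (rule holomorphic_transform)
    show "(deriv ^^ j) (\<lambda>w. F w n) holomorphic_on ball z r"
      using holomorphic_higher_deriv[OF hol U(1)] sub holomorphic_on_subset by blast
  qed (use G sub in auto)
  have bG: "cmod (?G w n) \<le> fact j * B / r ^ j" if w: "w \<in> ball z r" for w n
  proof -
    have "cmod ((deriv ^^ j) (\<lambda>w. F w n) w) \<le> fact j * B / r ^ j"
    proof (rule Cauchy_inequality)
      have h: "(\<lambda>w. F w n) holomorphic_on cball w r" using hol inU[OF w] holomorphic_on_subset by blast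
      then show "(\<lambda>w. F w n) holomorphic_on ball w r" using ball_subset_cball holomorphic_on_subset by blast
      show "continuous_on (cball w r) (\<lambda>w. F w n)" using h by (rule holomorphic_on_imp_continuous_on)
      show "cmod (F x n) \<le> B" if "cmod (w - x) = r" for x
        using B inU[OF w] that by (auto simp: dist_norm)
    qed fact
    then show ?thesis using G sub w by auto
  qed
  have zr: "z \<in> ball z r" using r by simp
  have "Sigma_deriv ?G z = (\<lambda>n. deriv (\<lambda>w. ?G w n) z)"
  proof (rule Sigma_deriv_eq[OF open_ball zr])
    show "?G w \<in> ell_inf" if "w \<in> ball z r" for w
      using bG[OF that] by (rule ell_infI)
    show "Sigma_has_deriv ?G (\<lambda>n. deriv (\<lambda>w. ?G w n) z) z"
      using holG bG by (intro Sigma_has_derivI[OF open_ball zr])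
  qed
  also have "\<dots> = (\<lambda>n. deriv ((deriv ^^ j) (\<lambda>w. F w n)) z)"
  proof
    fix n
    have "eventually (\<lambda>w. w \<in> U) (nhds z)" using U(1) Suc.prems by (rule eventually_nhds_in_open)
    then have "eventually (\<lambda>w. ?G w n = (deriv ^^ j) (\<lambda>w. F w n) w) (nhds z)"
      by (rule eventually_mono) (rule G)
    then show "deriv (\<lambda>w. ?G w n) z = deriv ((deriv ^^ j) (\<lambda>w. F w n)) z"
      by (rule deriv_cong_ev) (rule refl)
  qed
  finally show ?case by simp
qed simp

section \<open>Boundary values of Calderon functions and their coordinates\<close>

lemma ell_1_diff:
  assumes "x \<in> ell_1" "y \<in> ell_1"
  shows "(\<lambda>n. x n - y n) \<in> ell_1"
proof -
  have "summable (\<lambda>n. cmod (x n) + cmod (y n))"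
    by (rule summable_add) (use assms in \<open>auto simp: ell_1_def\<close>)
  then have "summable (\<lambda>n. cmod (x n - y n))"
    by (rule summable_comparison_test'[where N = 0]) (simp add: norm_triangle_ineq4)
  then show ?thesis by (simp add: ell_1_def)
qed

lemma norm_1_diff_le:
  assumes "x \<in> ell_1" "y \<in> ell_1"
  shows "norm_1 x - norm_1 y \<le> norm_1 (\<lambda>n. x n - y n)"
proof -
  have s: "summable (\<lambda>n. cmod (x n))" "summable (\<lambda>n. cmod (y n))" "summable (\<lambda>n. cmod (x n - y n))"
    using assms ell_1_diff[OF assms] by (auto simp: ell_1_def)
  have "norm_1 x - norm_1 y = (\<Sum>n. cmod (x n) - cmod (y n))"
    unfolding norm_1_def by (rule suminf_diff[OF s(1,2)])
  also have "\<dots> \<le> norm_1 (\<lambda>n. x n - y n)"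
    unfolding norm_1_def
    by (rule suminf_le[OF norm_triangle_ineq2 summable_diff[OF s(1,2)] s(3)])
  finally show ?thesis .
qed

lemma norm_1_nonneg: "x \<in> ell_1 \<Longrightarrow> 0 \<le> norm_1 x"
  by (simp add: norm_1_def ell_1_def suminf_nonneg)

text \<open>\<open>calderon\<close> does not demand boundedness in the l_1 norm, but the supremum in
  \<open>calderon_norm\<close> is an upper bound only if it holds. It follows from continuity on a
  compact interval and the limit 0 at infinity.\<close>

lemma vanishing_path_ell_1_bdd:
  assumes "vanishing_path ell_1 norm_1 G"
  shows "bdd_above (range (\<lambda>t. norm_1 (G t)))"
proof -
  have G: "G t \<in> ell_1" and lim: "((\<lambda>s. norm_1 (\<lambda>n. G s n - G t n)) \<longlongrightarrow> 0) (at t)"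
    and inf: "((\<lambda>t. norm_1 (G t)) \<longlongrightarrow> 0) at_infinity" for t
    using assms by (auto simp: vanishing_path_def)
  have lip: "norm (norm_1 (G s) - norm_1 (G t)) \<le> norm_1 (\<lambda>n. G s n - G t n)" for s t
  proof -
    have "norm_1 (\<lambda>n. G s n - G t n) = norm_1 (\<lambda>n. G t n - G s n)"
      by (simp add: norm_1_def norm_minus_commute)
    then show ?thesis
      using norm_1_diff_le[OF G[of s] G[of t]] norm_1_diff_le[OF G[of t] G[of s]] by simp
  qed
  have "isCont (\<lambda>t. norm_1 (G t)) t" for t
    unfolding isCont_def
    by (rule LIM_zero_cancel, rule Lim_null_comparison[OF always_eventually lim]) (use lip in blast)
  then have cont: "continuous_on A (\<lambda>t. norm_1 (G t))" for A
    by (simp add: continuous_at_imp_continuous_on)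
  have "eventually (\<lambda>t. norm_1 (G t) < 1) at_infinity" using inf by (rule order_tendstoD) simp
  then obtain b where b: "\<And>t. b \<le> \<bar>t\<bar> \<Longrightarrow> norm_1 (G t) < 1"
    by (auto simp: eventually_at_infinity)
  have "bdd_above ((\<lambda>t. norm_1 (G t)) ` {-b..b})"
    by (intro bounded_imp_bdd_above compact_imp_bounded compact_continuous_image cont) simp
  then obtain c where c: "\<forall>t\<in>{-b..b}. norm_1 (G t) \<le> c"
    unfolding bdd_above_def by auto
  have "norm_1 (G t) \<le> max 1 c" for t
  proof (cases "b \<le> \<bar>t\<bar>")
    case True
    then show ?thesis using b[of t] by simp
  next
    case False
    then have "t \<in> {-b..b}" by auto
    then show ?thesis using c by (simp add: le_max_iff_disj)
  qed
  then show ?thesis by (auto intro!: bdd_aboveI[of _ "max 1 c"])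
qed

lemma open_strip_subset: "open_strip \<subseteq> strip"
  by (auto simp: open_strip_def strip_def)

text \<open>These scalar facts are all that the passage to the Orlicz space uses. The bound in the
  third claim is uniform in \<open>n\<close>, as the Cauchy estimates behind
  \<open>Sigma_higher_deriv\<close> require.\<close>

lemma calderon_coord:
  assumes F: "F \<in> calderon"
  shows "continuous_on strip (\<lambda>z. F z n)"
    and "(\<lambda>z. F z n) holomorphic_on open_strip"
    and "\<exists>B. \<forall>z\<in>strip. \<forall>n. cmod (F z n) \<le> B"
    and "cmod (F (Complex 0 t) n) \<le> calderon_norm F"
    and "F (Complex 1 t) \<in> ell_1"
    and "norm_1 (F (Complex 1 t)) \<le> calderon_norm F"
proof -
  have inf: "F z \<in> ell_inf" if "z \<in> strip" for z
    using F that unfolding calderon_def Sigma_space_eq by blast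
  have cts: "((\<lambda>w. Sigma_norm (\<lambda>n. F w n - F z n)) \<longlongrightarrow> 0) (at z within strip)" if "z \<in> strip" for z
    using F that unfolding calderon_def by blast
  show "continuous_on strip (\<lambda>z. F z n)"
    unfolding continuous_on_def
  proof (intro ballI, rule LIM_zero_cancel)
    fix z assume z: "z \<in> strip"
    show "((\<lambda>w. F w n - F z n) \<longlongrightarrow> 0) (at z within strip)"
    proof (rule Lim_null_comparison[OF _ cts[OF z]])
      have "eventually (\<lambda>w. w \<in> strip) (at z within strip)" by (simp add: eventually_at_filter)
      then show "eventually (\<lambda>w. norm (F w n - F z n) \<le> Sigma_norm (\<lambda>n. F w n - F z n)) (at z within strip)"
      proof eventually_elim
        case (elim w)
        then have "(\<lambda>n. F w n - F z n) \<in> ell_inf" using inf z ell_inf_diff by blast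
        then show ?case using cmod_le_norm_inf[of "\<lambda>n. F w n - F z n" n] Sigma_norm_eq by simp
      qed
    qed
  qed
  show "(\<lambda>z. F z n) holomorphic_on open_strip"
    unfolding holomorphic_on_open[OF open_open_strip]
  proof
    fix z assume z: "z \<in> open_strip"
    then obtain D where "Sigma_has_deriv F D z" using F unfolding calderon_def by blast
    then have "((\<lambda>w. F w n) has_field_derivative D n) (at z)"
      using inf open_strip_subset
      by (intro Sigma_has_deriv_coord[where U = open_strip and F = F] open_open_strip z) auto
    then show "\<exists>f'. ((\<lambda>z. F z n) has_field_derivative f') (at z)" by blast
  qed
  obtain B where B: "\<And>z. z \<in> strip \<Longrightarrow> Sigma_norm (F z) \<le> B"
    using F unfolding calderon_def by blast
  have B': "norm_inf (F z) \<le> B" if "z \<in> strip" for z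
    using B[OF that] inf[OF that] Sigma_norm_eq by simp
  then show "\<exists>B. \<forall>z\<in>strip. \<forall>n. cmod (F z n) \<le> B"
    by (intro exI[of _ B] ballI allI) (rule order_trans[OF cmod_le_norm_inf[OF inf]])
  have s0: "Complex 0 t \<in> strip" for t by (simp add: strip_def)
  have "cmod (F (Complex 0 t) n) \<le> norm_inf (F (Complex 0 t))" by (rule cmod_le_norm_inf[OF inf[OF s0]])
  also have "\<dots> \<le> (SUP t. norm_inf (F (Complex 0 t)))"
    using B'[OF s0] by (intro cSUP_upper bdd_aboveI[of _ B]) auto
  finally show "cmod (F (Complex 0 t) n) \<le> calderon_norm F" by (simp add: calderon_norm_def)
  have vp: "vanishing_path ell_1 norm_1 (\<lambda>t. F (Complex 1 t))"
    using F unfolding calderon_def by blast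
  then show "F (Complex 1 t) \<in> ell_1" by (simp add: vanishing_path_def)
  have "norm_1 (F (Complex 1 t)) \<le> (SUP t. norm_1 (F (Complex 1 t)))"
    using vanishing_path_ell_1_bdd[OF vp] by (intro cSUP_upper) auto
  then show "norm_1 (F (Complex 1 t)) \<le> calderon_norm F" by (simp add: calderon_norm_def)
qed

lemma calderon_norm_nonneg: "F \<in> calderon \<Longrightarrow> 0 \<le> calderon_norm F"
  using norm_1_nonneg[OF calderon_coord(5)[of F 0]] calderon_coord(6)[of F 0] by linarith

lemma Delta_eq:
  assumes "F \<in> calderon"
  shows "Delta j F = (\<lambda>n. (deriv ^^ j) (\<lambda>z. F z n) (1/2) / fact j)"
proof -
  obtain B where "\<And>z n. z \<in> strip \<Longrightarrow> cmod (F z n) \<le> B" using calderon_coord(3)[OF assms] by blast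
  then have "(Sigma_deriv ^^ j) F (1/2) = (\<lambda>n. (deriv ^^ j) (\<lambda>z. F z n) (1/2))"
    using calderon_coord(2)[OF assms] open_strip_subset
    by (intro Sigma_higher_deriv[OF open_open_strip, of _ _ B]) (auto simp: open_strip_def)
  then show ?thesis by (simp add: Delta_def)
qed

text \<open>A null majorant takes care of all but finitely many coordinates at once. A constant
  majorant would not do; this is where sizes tending to 0 along the coordinates become
  necessary.\<close>

lemma norm_inf_tendsto_0:
  assumes lim: "\<And>n. ((\<lambda>w. G w n) \<longlongrightarrow> 0) F" and dom: "eventually (\<lambda>w. \<forall>n. cmod (G w n) \<le> b n) F"
    and b: "b \<longlonglongrightarrow> 0"
  shows "((\<lambda>w. norm_inf (G w)) \<longlongrightarrow> 0) F"
proof (rule tendstoI)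
  fix e :: real assume e: "0 < e"
  have "eventually (\<lambda>n. b n < e / 2) sequentially"
    using order_tendstoD(2)[OF b, of "e / 2"] e by simp
  then obtain N where N: "\<forall>n\<ge>N. b n < e / 2"
    unfolding eventually_sequentially by blast
  have "eventually (\<lambda>w. cmod (G w n) < e / 2) F" for n
    using tendstoD[OF lim[of n], of "e / 2"] e by simp
  then have head: "eventually (\<lambda>w. \<forall>n\<in>{..<N}. cmod (G w n) < e / 2) F"
    by (intro eventually_ball_finite) auto
  show "eventually (\<lambda>w. dist (norm_inf (G w)) 0 < e) F"
  proof (rule eventually_elim2[OF dom head])
    fix w assume *: "\<forall>n. cmod (G w n) \<le> b n" "\<forall>n\<in>{..<N}. cmod (G w n) < e / 2"
    have le: "cmod (G w n) \<le> e / 2" for n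
    proof (cases "n < N")
      case True
      then show ?thesis using *(2) by (simp add: less_imp_le)
    next
      case False
      then have "b n < e / 2" using N by simp
      with *(1)[rule_format, of n] show ?thesis by linarith
    qed
    have "0 \<le> norm_inf (G w)" using norm_inf_nonneg[OF ell_infI[OF le]] .
    then show "dist (norm_inf (G w)) 0 < e"
      using norm_inf_le[of "G w", OF le] e by (simp add: dist_real_def)
  qed
qed

lemma norm_1_tendsto_0:
  assumes lim: "\<And>n. ((\<lambda>w. G w n) \<longlongrightarrow> 0) F" and dom: "\<And>w n. cmod (G w n) \<le> b n"
    and b: "summable b" and F: "F \<noteq> bot"
  shows "((\<lambda>w. norm_1 (G w)) \<longlongrightarrow> 0) F"
proof -
  have "((\<lambda>w. \<Sum>n. cmod (G w n)) \<longlongrightarrow> (\<Sum>n. 0)) F"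
  proof -
    have "((\<lambda>w. cmod (G w n)) \<longlongrightarrow> 0) F" for n
      using tendsto_norm_zero[OF lim] .
    moreover have "eventually (\<lambda>(n, w). norm (cmod (G w n)) \<le> b n) (at_top \<times>\<^sub>F F)"
      using dom by (intro always_eventually) auto
    ultimately show ?thesis
      using tannerys_theorem[of "\<lambda>n w. cmod (G w n)" "\<lambda>n. 0" F b] b F by blast
  qed
  then show ?thesis by (simp add: norm_1_def)
qed

text \<open>The majorant \<open>s n\<close> yields continuity in the sup norm, the summable majorant
  \<open>r n\<close> continuity in the l_1 norm on the right line, and \<kappa> makes every
  coordinate vanish at infinity along the boundary lines.\<close>

lemma calderonI:
  fixes F :: "complex \<Rightarrow> cseq" and \<kappa> :: "real \<Rightarrow> real"
  assumes cont: "\<And>n. continuous_on strip (\<lambda>z. F z n)"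
    and hol: "\<And>n. (\<lambda>z. F z n) holomorphic_on open_strip"
    and dom: "\<And>z n. z \<in> strip \<Longrightarrow> cmod (F z n) \<le> s n * \<kappa> (Im z)"
    and s: "s \<longlonglongrightarrow> 0" "\<And>n. 0 \<le> s n" "\<And>n. s n \<le> S"
    and \<kappa>: "(\<kappa> \<longlongrightarrow> 0) at_infinity" "\<And>t. 0 \<le> \<kappa> t" "\<And>t. \<kappa> t \<le> K"
    and right: "\<And>t n. cmod (F (Complex 1 t) n) \<le> r n * \<kappa> t" and r: "summable r" "\<And>n. 0 \<le> r n"
  shows "F \<in> calderon \<and> calderon_norm F \<le> max S (suminf r) * K"
proof -
  have S0: "0 \<le> S" using s(2,3)[of 0] by linarith
  have K0: "0 \<le> K" using \<kappa>(2,3)[of 0] by linarith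
  have domK: "cmod (F z n) \<le> s n * K" if "z \<in> strip" for z n
    using dom[OF that, of n] \<kappa>(3) s(2) by (meson mult_left_mono order_trans)
  have domSK: "cmod (F z n) \<le> S * K" if "z \<in> strip" for z n
    using domK[OF that, of n] s(3) K0 by (meson mult_right_mono order_trans)
  have rK: "cmod (F (Complex 1 t) n) \<le> r n * K" for t n
    using right[of t n] \<kappa>(3) r(2) by (meson mult_left_mono order_trans)
  have "(\<lambda>n. s n * K + s n * K) \<longlonglongrightarrow> 0 * K + 0 * K" by (intro tendsto_intros s)
  moreover have "(\<lambda>n. s n * K) \<longlonglongrightarrow> 0 * K" by (intro tendsto_intros s)
  ultimately have sK: "(\<lambda>n. s n * K + s n * K) \<longlonglongrightarrow> 0" and sK': "(\<lambda>n. s n * K) \<longlonglongrightarrow> 0" by simp_all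
  have inf: "F z \<in> ell_inf" if "z \<in> strip" for z using domSK[OF that] by (rule ell_infI)
  have s0: "Complex 0 t \<in> strip" and s1: "Complex 1 t \<in> strip" for t by (simp_all add: strip_def)
  have ell1: "F (Complex 1 t) \<in> ell_1" for t
    unfolding ell_1_def using rK summable_mult2[OF r(1), of K]
    by (auto intro: summable_comparison_test'[where N = 0])
  have cont_norm: "((\<lambda>w. norm_inf (\<lambda>n. F w n - F z n)) \<longlongrightarrow> 0) (at z within strip)" if z: "z \<in> strip" for z
  proof (rule norm_inf_tendsto_0[OF _ _ sK])
    show "((\<lambda>w. F w n - F z n) \<longlongrightarrow> 0) (at z within strip)" for n
      by (rule LIM_zero) (use cont z in \<open>simp add: continuous_on_def\<close>)
    have "eventually (\<lambda>w. w \<in> strip) (at z within strip)" by (simp add: eventually_at_filter)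
    then show "eventually (\<lambda>w. \<forall>n. cmod (F w n - F z n) \<le> s n * K + s n * K) (at z within strip)"
      by eventually_elim (meson add_mono domK norm_triangle_ineq4 order_trans z)
  qed
  have path: "((\<lambda>t. F (Complex x t) n - F (Complex x t0) n) \<longlongrightarrow> 0) (at t0)" if "x = 0 \<or> x = 1" for x t0 n
  proof -
    have "continuous_on UNIV ((\<lambda>z. F z n) \<circ> Complex x)"
      using that by (intro continuous_on_compose continuous_on_subset[OF cont])
        (auto intro!: continuous_intros simp: strip_def)
    then show ?thesis by (intro LIM_zero[where l = "F (Complex x t0) n"]) (simp add: continuous_on_def o_def)
  qed
  have far: "((\<lambda>t. F (Complex x t) n) \<longlongrightarrow> 0) at_infinity" if "x = 0 \<or> x = 1" for x n
  proof (rule Lim_null_comparison)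
    show "eventually (\<lambda>t. norm (F (Complex x t) n) \<le> s n * \<kappa> t) at_infinity"
      using dom[of "Complex x _" n] that by (intro always_eventually) (auto simp: strip_def)
    show "((\<lambda>t. s n * \<kappa> t) \<longlongrightarrow> 0) at_infinity" using tendsto_mult_right_zero[OF \<kappa>(1)] .
  qed
  have vp0: "vanishing_path ell_inf norm_inf (\<lambda>t. F (Complex 0 t))"
    unfolding vanishing_path_def
  proof (intro conjI allI)
    show "((\<lambda>u. norm_inf (\<lambda>n. F (Complex 0 u) n - F (Complex 0 t) n)) \<longlongrightarrow> 0) (at t)" for t
    proof (rule norm_inf_tendsto_0[OF _ _ sK])
      show "((\<lambda>u. F (Complex 0 u) n - F (Complex 0 t) n) \<longlongrightarrow> 0) (at t)" for n
        by (rule path) simp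
      show "eventually (\<lambda>u. \<forall>n. cmod (F (Complex 0 u) n - F (Complex 0 t) n) \<le> s n * K + s n * K) (at t)"
        by (intro always_eventually allI order_trans[OF norm_triangle_ineq4 add_mono] domK s0)
    qed
    show "((\<lambda>t. norm_inf (F (Complex 0 t))) \<longlongrightarrow> 0) at_infinity"
    proof (rule norm_inf_tendsto_0[OF _ _ sK'])
      show "((\<lambda>t. F (Complex 0 t) n) \<longlongrightarrow> 0) at_infinity" for n
        by (rule far) simp
      show "eventually (\<lambda>t. \<forall>n. cmod (F (Complex 0 t) n) \<le> s n * K) at_infinity"
        by (intro always_eventually allI domK s0)
    qed
    show "F (Complex 0 t) \<in> ell_inf" for t by (rule inf[OF s0])
  qed
  have vp1: "vanishing_path ell_1 norm_1 (\<lambda>t. F (Complex 1 t))"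
    unfolding vanishing_path_def
  proof (intro conjI allI)
    have sm: "summable (\<lambda>n. r n * K)" using r(1) by (rule summable_mult2)
    show "((\<lambda>u. norm_1 (\<lambda>n. F (Complex 1 u) n - F (Complex 1 t) n)) \<longlongrightarrow> 0) (at t)" for t
    proof (rule norm_1_tendsto_0[OF _ _ summable_add[OF sm sm]])
      show "((\<lambda>u. F (Complex 1 u) n - F (Complex 1 t) n) \<longlongrightarrow> 0) (at t)" for n
        by (rule path) simp
      show "cmod (F (Complex 1 u) n - F (Complex 1 t) n) \<le> r n * K + r n * K" for u n
        by (intro order_trans[OF norm_triangle_ineq4 add_mono] rK)
    qed simp
    show "((\<lambda>t. norm_1 (F (Complex 1 t))) \<longlongrightarrow> 0) at_infinity"
    proof (rule norm_1_tendsto_0[OF _ _ sm])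
      show "((\<lambda>t. F (Complex 1 t) n) \<longlongrightarrow> 0) at_infinity" for n
        by (rule far) simp
      show "cmod (F (Complex 1 t) n) \<le> r n * K" for t n by (rule rK)
    qed (rule trivial_limit_at_infinity)
    show "F (Complex 1 t) \<in> ell_1" for t by (rule ell1)
  qed
  have "F \<in> calderon"
    unfolding calderon_def
  proof (intro CollectI conjI ballI)
    show "\<exists>B. \<forall>z\<in>strip. Sigma_norm (F z) \<le> B"
      using domSK norm_inf_le inf Sigma_norm_eq by metis
    show "((\<lambda>w. Sigma_norm (\<lambda>n. F w n - F z n)) \<longlongrightarrow> 0) (at z within strip)" if z: "z \<in> strip" for z
    proof (rule Lim_transform_eventually[OF cont_norm[OF z]])
      have "eventually (\<lambda>w. w \<in> strip) (at z within strip)" by (simp add: eventually_at_filter)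
      then show "eventually (\<lambda>w. norm_inf (\<lambda>n. F w n - F z n) = Sigma_norm (\<lambda>n. F w n - F z n)) (at z within strip)"
        by eventually_elim (use inf z ell_inf_diff Sigma_norm_eq in simp)
    qed
    show "\<exists>D. Sigma_has_deriv F D z" if "z \<in> open_strip" for z
      using domSK open_strip_subset
      by (intro exI) (rule Sigma_has_derivI[where B = "S * K", OF open_open_strip that hol], blast)
    show "F z \<in> Sigma_space" if "z \<in> strip" for z
      unfolding Sigma_space_eq by (rule inf[OF that])
  qed (rule vp0, rule vp1)
  have "(SUP t. norm_inf (F (Complex 0 t))) \<le> S * K"
    by (intro cSUP_least norm_inf_le domSK s0) auto
  moreover have "(SUP t. norm_1 (F (Complex 1 t))) \<le> suminf r * K"
  proof (rule cSUP_least)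
    show "norm_1 (F (Complex 1 t)) \<le> suminf r * K" for t
      unfolding norm_1_def suminf_mult2[OF r(1)] using rK ell1 r(1)
      by (intro suminf_le) (auto simp: ell_1_def intro: summable_mult2)
  qed auto
  moreover have "S * K \<le> max S (suminf r) * K" "suminf r * K \<le> max S (suminf r) * K"
    using K0 by (auto intro: mult_right_mono)
  ultimately have "calderon_norm F \<le> max S (suminf r) * K"
    unfolding calderon_norm_def by linarith
  with \<open>F \<in> calderon\<close> show ?thesis ..
qed

section \<open>From the Calderon space to the Orlicz space\<close>

lemma orlicz_near_0:
  assumes M: "orlicz_function M" and near0: "\<forall>\<^sub>F t in at_right 0. M t = t\<^sup>2 * ln t ^ (2 * k)"
  obtains d where "0 < d" and "\<And>t. 0 \<le> t \<Longrightarrow> t < d \<Longrightarrow> M t = t\<^sup>2 * ln t ^ (2 * k)"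
proof -
  obtain d where d: "d > 0" "\<And>t. 0 < t \<Longrightarrow> t < d \<Longrightarrow> M t = t\<^sup>2 * ln t ^ (2 * k)"
    using near0 unfolding eventually_at_right_field by auto
  have "M t = t\<^sup>2 * ln t ^ (2 * k)" if "0 \<le> t" "t < d" for t
    using d(2)[of t] that M by (cases "t = 0") (auto simp: orlicz_function_def)
  with d(1) show thesis by (rule that)
qed

lemma orlicz_mono: "orlicz_function M \<Longrightarrow> 0 \<le> s \<Longrightarrow> s \<le> t \<Longrightarrow> M s \<le> M t"
  by (auto simp: orlicz_function_def mono_on_def)

lemma orlicz_nonneg: "orlicz_function M \<Longrightarrow> 0 \<le> t \<Longrightarrow> 0 \<le> M t"
  using orlicz_mono[of M 0 t] by (simp add: orlicz_function_def)

text \<open>Convexity between 0 and \<open>t\<close>. This is how a finite modular is pushed below 1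
  by enlarging the scale.\<close>

lemma orlicz_divide_le:
  assumes M: "orlicz_function M" and t: "0 \<le> t" and A: "1 \<le> A"
  shows "M (t / A) \<le> M t / A"
proof -
  have conv: "convex_on {0..} M" and M0: "M 0 = 0" using M by (auto simp: orlicz_function_def)
  have "M ((1 - 1 / A) *\<^sub>R 0 + (1 / A) *\<^sub>R t) \<le> (1 - 1 / A) * M 0 + (1 / A) * M t"
    using A t by (intro convex_onD[OF conv]) auto
  then show ?thesis using M0 by simp
qed

section \<open>Summable means over the right line\<close>

lemma sum_boundary_integrals_le_pi:
  assumes ell1: "\<And>t. x t \<in> ell_1" and bound: "\<And>t. norm_1 (x t) \<le> 1"
    and cont: "\<And>n. continuous_on UNIV (\<lambda>t. x t n)"
    and T: "0 \<le> T"
  shows "(\<Sum>n<K. integral {-T..T} (\<lambda>t. cmod (x t n) / (1 + t\<^sup>2))) \<le> pi"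
proof -
  have int: "(\<lambda>t. cmod (x t n) / (1 + t\<^sup>2)) integrable_on {-T..T}" for n
    by (intro integrable_continuous_real continuous_intros continuous_on_subset[OF cont])
       (auto simp: add_nonneg_eq_0_iff)
  have "(\<Sum>n<K. integral {-T..T} (\<lambda>t. cmod (x t n) / (1 + t\<^sup>2)))
      = integral {-T..T} (\<lambda>t. \<Sum>n<K. cmod (x t n) / (1 + t\<^sup>2))"
    using int by (intro integral_sum[symmetric]) auto
  also have "\<dots> \<le> integral {-T..T} (\<lambda>t. 1 / (1 + t\<^sup>2))"
  proof (rule integral_le)
    show "(\<lambda>t. \<Sum>n<K. cmod (x t n) / (1 + t\<^sup>2)) integrable_on {-T..T}"
      using int by (intro integrable_sum) auto
    show "(\<lambda>t. 1 / (1 + t\<^sup>2)) integrable_on {-T..T}"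
      by (rule integral_inverse_1_plus_square_le_pi(1)[OF T])
    show "(\<Sum>n<K. cmod (x t n) / (1 + t\<^sup>2)) \<le> 1 / (1 + t\<^sup>2)" for t
    proof -
      have "summable (\<lambda>n. cmod (x t n))" using ell1[of t] by (simp add: ell_1_def)
      then have "(\<Sum>n<K. cmod (x t n)) \<le> norm_1 (x t)"
        unfolding norm_1_def by (intro sum_le_suminf) auto
      then have "(\<Sum>n<K. cmod (x t n)) \<le> 1" using bound[of t] by linarith
      then show ?thesis
        unfolding sum_divide_distrib[symmetric] by (intro divide_right_mono) auto
    qed
  qed
  also have "\<dots> \<le> pi" by (rule integral_inverse_1_plus_square_le_pi(2)[OF T])
  finally show ?thesis .
qed

text \<open>The weights are the full-line means of the coordinates, obtained as suprema over the
  intervals [-N, N]; partial sums over \<open>n\<close> pass to this monotone limit and keep the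
  bound pi.\<close>

lemma boundary_weights:
  fixes x :: "real \<Rightarrow> cseq"
  assumes ell1: "\<And>t. x t \<in> ell_1" and bound: "\<And>t. norm_1 (x t) \<le> 1"
    and cont: "\<And>n. continuous_on UNIV (\<lambda>t. x t n)"
  obtains m :: "nat \<Rightarrow> real" where "\<And>n. 0 < m n" "summable m" "suminf m \<le> 6"
    "\<And>n N. integral {-real N..real N} (\<lambda>t. cmod (x t n) / (1 + t\<^sup>2)) \<le> m n"
proof -
  define I where "I n N = integral {-real N..real N} (\<lambda>t. cmod (x t n) / (1 + t\<^sup>2))" for n N
  define \<mu> where "\<mu> n = (SUP N. I n N)" for n
  have int: "(\<lambda>t. cmod (x t n) / (1 + t\<^sup>2)) integrable_on {-T..T}" for n T
    by (intro integrable_continuous_real continuous_intros continuous_on_subset[OF cont])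
       (auto simp: add_nonneg_eq_0_iff)
  have I0: "0 \<le> I n N" for n N unfolding I_def by (intro integral_nonneg int) auto
  have sum_I: "(\<Sum>n<K. I n N) \<le> pi" for K N
    unfolding I_def using sum_boundary_integrals_le_pi[OF ell1 bound cont] by simp
  have I_pi: "I n N \<le> pi" for n N
    using sum_I[of N "Suc n"] sum_nonneg[of "{..<n}" "\<lambda>n. I n N"] I0 by simp
  have bdd: "bdd_above (range (I n))" for n
    using I_pi by (intro bdd_aboveI[of _ pi]) auto
  have inc: "incseq (I n)" for n
    unfolding incseq_def I_def
    by (intro allI impI integral_subset_le int) auto
  have I_\<mu>: "I n N \<le> \<mu> n" for n N unfolding \<mu>_def using bdd by (intro cSUP_upper) auto
  have \<mu>0: "0 \<le> \<mu> n" for n using I0 I_\<mu> order_trans by blast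
  have lim: "I n \<longlonglongrightarrow> \<mu> n" for n
    unfolding \<mu>_def by (rule LIMSEQ_incseq_SUP[OF bdd inc])
  have sum_\<mu>: "(\<Sum>n<K. \<mu> n) \<le> pi" for K
  proof (rule LIMSEQ_le_const2)
    show "(\<lambda>N. \<Sum>n<K. I n N) \<longlonglongrightarrow> (\<Sum>n<K. \<mu> n)" by (intro tendsto_sum lim)
    show "\<exists>N. \<forall>n\<ge>N. (\<Sum>j<K. I j n) \<le> pi" using sum_I by blast
  qed
  have s\<mu>: "summable \<mu>" using \<mu>0 sum_\<mu> by (rule summableI_nonneg_bounded)
  have t\<mu>: "suminf \<mu> \<le> pi" using s\<mu> sum_\<mu> by (rule suminf_le_const)
  have geo: "(\<lambda>n. (1/2::real) ^ n) sums 2" using geometric_sums[of "1/2::real"] by simp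
  \<comment> \<open>The geometric term makes every weight positive, so that its logarithm is
    meaningful even for a coordinate vanishing on the right line. It adds 2 to a sum of at most pi,
    whence the bound 6.\<close>
  define m where "m n = \<mu> n + (1/2) ^ n" for n
  have "summable m" "suminf m = suminf \<mu> + 2"
    unfolding m_def using summable_add[OF s\<mu> sums_summable[OF geo]]
      suminf_add[OF s\<mu> sums_summable[OF geo]] sums_unique[OF geo] by auto
  moreover have "0 < m n" for n unfolding m_def using \<mu>0[of n] by (intro add_nonneg_pos) auto
  moreover have "I n N \<le> m n" for n N unfolding m_def using I_\<mu>[of n N] by (intro add_increasing2) auto
  moreover have "suminf \<mu> + 2 \<le> 6" using t\<mu> pi_less_4 by linarith
  ultimately show thesis by (intro that[of m]) (auto simp: I_def)
qed

lemma power_1_plus_le: "(1 + a) ^ k \<le> 2 ^ k * (1 + a ^ k)" if "0 \<le> a" for a :: real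
proof -
  have "(1 + a) ^ k \<le> (2 * max 1 a) ^ k" using that by (intro power_mono) auto
  also have "\<dots> = 2 ^ k * max 1 a ^ k" by (rule power_mult_distrib)
  also have "max 1 a ^ k \<le> 1 + a ^ k" using that by (cases "a \<le> 1") (auto simp: max_def)
  finally show ?thesis by simp
qed

text \<open>Both spaces are treated at once: \<open>k = 1\<close> and \<open>k = 2\<close> are the
  two kernels of the theorem, and \<open>k = 0\<close> is the whole Calderon space.\<close>

definition kernel_Delta :: "nat \<Rightarrow> (complex \<Rightarrow> cseq) set" where
  "kernel_Delta k = {F \<in> calderon. \<forall>j\<in>{1..k}. Delta j F = (\<lambda>n. 0)}"

text \<open>\<open>N\<close> is a positive upper bound instead of the norm, so normalising by it is
  possible even for F of norm 0.\<close>

lemma kernel_centre_weights: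
  assumes F: "F \<in> kernel_Delta k" and N: "0 < N" "calderon_norm F \<le> N"
  obtains m :: "nat \<Rightarrow> real" where "\<And>n. 0 < m n" "summable m" "suminf m \<le> 6"
    "\<And>n. cmod (F (1/2) n) / N * (1 + \<bar>ln (m n)\<bar>) ^ k \<le> 2 ^ k * (5 + 5 * fact k * 4 ^ k) * sqrt (m n)"
proof -
  have C: "F \<in> calderon" using F by (simp add: kernel_Delta_def)
  define f where "f n z = F z n / N" for n z
  have contf: "continuous_on strip (f n)" for n
    unfolding f_def using N calderon_coord(1)[OF C, of n] by (intro continuous_intros) auto
  have holf: "f n holomorphic_on open_strip" for n
    unfolding f_def using N calderon_coord(2)[OF C, of n] by (intro holomorphic_intros) auto
  obtain B where B: "\<forall>z\<in>strip. \<forall>n. cmod (F z n) \<le> B" using calderon_coord(3)[OF C] by blast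
  have Bf: "cmod (f n z) \<le> B / N" if "z \<in> strip" for n z
    using B that N by (simp add: f_def norm_divide divide_right_mono)
  have left: "cmod (f n (Complex 0 t)) \<le> 1" for n t
    using calderon_coord(4)[OF C, of t n] N by (simp add: f_def norm_divide)
  have s1: "summable (\<lambda>n. cmod (F (Complex 1 t) n))" for t
    using calderon_coord(5)[OF C, of t] by (simp add: ell_1_def)
  have eq: "cmod (f n (Complex 1 t)) = cmod (F (Complex 1 t) n) / N" for n t
    using N by (simp add: f_def norm_divide)
  have ell1: "(\<lambda>n. f n (Complex 1 t)) \<in> ell_1" for t
    unfolding ell_1_def eq mem_Collect_eq by (rule summable_divide[OF s1])
  have bound: "norm_1 (\<lambda>n. f n (Complex 1 t)) \<le> 1" for t
  proof -
    have "norm_1 (\<lambda>n. f n (Complex 1 t)) = norm_1 (F (Complex 1 t)) / N"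
      unfolding norm_1_def eq by (rule suminf_divide[OF s1])
    then show ?thesis using calderon_coord(6)[OF C, of t] N by simp
  qed
  have cont1: "continuous_on UNIV (\<lambda>t. f n (Complex 1 t))" for n
  proof -
    have "continuous_on UNIV (f n \<circ> Complex 1)"
      by (intro continuous_on_compose continuous_on_subset[OF contf])
        (auto intro!: continuous_intros simp: strip_def)
    then show ?thesis by (simp add: o_def)
  qed
  obtain m where m: "\<And>n. 0 < m n" "summable m" "suminf m \<le> 6"
    "\<And>n N. integral {-real N..real N} (\<lambda>t. cmod (f n (Complex 1 t)) / (1 + t\<^sup>2)) \<le> m n"
    using boundary_weights[OF ell1 bound cont1] by blast
  have flat: "(deriv ^^ j) (f n) (1/2) = 0" if "1 \<le> j" "j \<le> k" for j n
  proof -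
    have "Delta j F = (\<lambda>n. 0)" using F that by (simp add: kernel_Delta_def)
    then have "(deriv ^^ j) (\<lambda>z. F z n) (1/2) = 0"
      unfolding Delta_eq[OF C] by (simp add: fun_eq_iff)
    moreover have "f n = (\<lambda>z. (1 / N) * F z n)" by (simp add: f_def fun_eq_iff)
    moreover have "(deriv ^^ j) (\<lambda>z. (1 / N) * F z n) (1/2) = (1 / N) * (deriv ^^ j) (\<lambda>z. F z n) (1/2)"
      by (rule higher_deriv_cmult[OF calderon_coord(2)[OF C] _ open_open_strip]) (simp add: open_strip_def)
    ultimately show ?thesis by simp
  qed
  have "cmod (F (1/2) n) / N * (1 + \<bar>ln (m n)\<bar>) ^ k \<le> 2 ^ k * (5 + 5 * fact k * 4 ^ k) * sqrt (m n)" for n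
  proof -
    let ?a = "\<bar>ln (m n)\<bar>" and ?\<tau> = "cmod (f n (1/2))"
    \<comment> \<open>Near \<open>m n = 1\<close> the estimate with the logarithm is empty;
      combining it with the one of order 0 gives the factor 1 + |ln (m n)|, which is bounded away
      from 0.\<close>
    have b0: "?\<tau> \<le> 5 * sqrt (m n)"
      using flat_centre_bound[OF contf[of n] holf Bf left m(4) m(1), of 0] by simp
    have bk: "?\<tau> * ?a ^ k \<le> 5 * fact k * 4 ^ k * sqrt (m n)"
      by (rule flat_centre_bound[OF contf holf Bf left m(4) m(1) flat])
    have "?\<tau> * (1 + ?a) ^ k \<le> ?\<tau> * (2 ^ k * (1 + ?a ^ k))"
      by (intro mult_left_mono power_1_plus_le) auto
    also have "\<dots> = 2 ^ k * (?\<tau> + ?\<tau> * ?a ^ k)" by (simp add: algebra_simps)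
    also have "\<dots> \<le> 2 ^ k * (5 * sqrt (m n) + 5 * fact k * 4 ^ k * sqrt (m n))"
      using b0 bk by (intro mult_left_mono add_mono) auto
    finally show ?thesis using N by (simp add: f_def norm_divide algebra_simps)
  qed
  then show thesis using that m(1-3) by blast
qed

text \<open>The admissible scales themselves; working with them postpones infima, which need not be
  known to be attained, to the very end.\<close>

definition luxemburg :: "(real \<Rightarrow> real) \<Rightarrow> cseq \<Rightarrow> real set" where
  "luxemburg M x =
     {\<rho>. \<rho> > 0 \<and> summable (\<lambda>n. M (cmod (x n) / \<rho>)) \<and> (\<Sum>n. M (cmod (x n) / \<rho>)) \<le> 1}"

text \<open>The values u = sqrt m / (1 + |ln m|)^k satisfy |ln u| = O(1 + |ln m|), so u^2 (ln
  u)^(2k) = O(m), and the weights are summable. Up to constants, the coordinates at the centre are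
  at most these values.\<close>

lemma kernel_imp_orlicz:
  assumes M: "orlicz_function M" and near0: "\<forall>\<^sub>F t in at_right 0. M t = t\<^sup>2 * ln t ^ (2 * k)"
  shows "\<exists>C>0. \<forall>F\<in>kernel_Delta k. \<forall>N>0. calderon_norm F \<le> N \<longrightarrow> C * N \<in> luxemburg M (F (1/2))"
proof -
  obtain d where d: "0 < d" "\<And>t. 0 \<le> t \<Longrightarrow> t < d \<Longrightarrow> M t = t\<^sup>2 * ln t ^ (2 * k)"
    using orlicz_near_0[OF M near0] by blast
  \<comment> \<open>From m n <= 6 < 9 one gets sqrt (m n) < 3; dividing by \<open>A\<close> then
    lands below \<open>d\<close>, where the formula for \<open>M\<close> is valid.\<close>
  define A where "A = max 1 (3 / d)"
  have A: "1 \<le> A" "3 / A \<le> d" using d(1) by (auto simp: A_def field_simps max_def)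
  \<comment> \<open>Its summands come from ln u = (ln m)/2 - ln A - k ln (1 + |ln m|), so that |ln
    u| <= (1 + |ln m|) B.\<close>
  define B where "B = 1 / 2 + ln A + real k"
  have B: "0 \<le> B" using A by (simp add: B_def)
  define C1 :: real where "C1 = 2 ^ k * (5 + 5 * fact k * 4 ^ k)"
  have C1: "0 < C1" by (simp add: C1_def add_pos_nonneg)
  \<comment> \<open>Without it the modular is bounded by 6 B^(2k), since the weights sum to at most
    6; convexity lets \<open>D\<close> bring this below 1.\<close>
  define D where "D = max 1 (6 * B ^ (2 * k))"
  have D: "1 \<le> D" "6 * B ^ (2 * k) \<le> D" by (auto simp: D_def)
  have p: "0 < C1 * A * D" using C1 A D by (intro mult_pos_pos) auto
  show ?thesis
  proof (intro exI[of _ "C1 * A * D"] conjI ballI allI impI)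
    show "0 < C1 * A * D" by (rule p)
    fix F N assume F: "F \<in> kernel_Delta k" and N: "0 < N" "calderon_norm F \<le> N"
    obtain m where m: "\<And>n. 0 < m n" "summable m" "suminf m \<le> 6"
      and c: "\<And>n. cmod (F (1/2) n) / N * (1 + \<bar>ln (m n)\<bar>) ^ k \<le> C1 * sqrt (m n)"
      unfolding C1_def using kernel_centre_weights[OF F N] by blast
    have m6: "m n \<le> 6" for n
    proof -
      have "sum m {n} \<le> suminf m" using m(1) by (intro sum_le_suminf m(2)) (auto simp: less_imp_le)
      then show ?thesis using m(3) by simp
    qed
    have le: "M (cmod (F (1/2) n) / (C1 * A * D * N)) \<le> B ^ (2 * k) / D * m n" for n
    proof -
      define a where "a = \<bar>ln (m n)\<bar>"
      define u where "u = sqrt (m n) / (A * (1 + a) ^ k)"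
      have a: "0 \<le> a" by (simp add: a_def)
      have p: "1 \<le> (1 + a) ^ k" using a by (intro one_le_power) auto
      have u0: "0 < u" unfolding u_def using A p m(1)[of n] by (intro divide_pos_pos mult_pos_pos) auto
      have sq: "sqrt (m n) < 3"
        using m6[of n] real_sqrt_less_mono[of "m n" 9] by simp
      have "u \<le> sqrt (m n) / (A * 1)"
        unfolding u_def using A p m(1)[of n] by (intro divide_left_mono mult_left_mono mult_pos_pos) (auto simp: less_imp_le)
      also have "\<dots> < 3 / A" using sq A by (simp add: divide_strict_right_mono)
      finally have ud: "u < d" using A by simp
      have "cmod (F (1/2) n) / (C1 * A * N) = cmod (F (1/2) n) / N / (C1 * A)" by (simp add: field_simps)
      also have "\<dots> \<le> (C1 * sqrt (m n) / (1 + a) ^ k) / (C1 * A)"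
        using c[of n] p C1 A by (intro divide_right_mono) (auto simp: a_def[symmetric] pos_le_divide_eq)
      also have "\<dots> = u" using C1 by (simp add: u_def field_simps)
      finally have tu: "cmod (F (1/2) n) / (C1 * A * N) \<le> u" .
      have "ln u = ln (m n) / 2 - (ln A + real k * ln (1 + a))"
        unfolding u_def using m(1)[of n] A p a
        by (simp add: ln_div ln_mult ln_sqrt ln_realpow)
      moreover have "0 \<le> ln (1 + a)" "ln (1 + a) \<le> a" using a ln_add_one_self_le_self[of a] by auto
      then have "0 \<le> real k * ln (1 + a)" "real k * ln (1 + a) \<le> real k * a"
        by (simp_all add: mult_left_mono)
      moreover have lnA: "0 \<le> ln A" using A by simp
      ultimately have "\<bar>ln u\<bar> \<le> a / 2 + (ln A + real k * a)"
        unfolding a_def by linarith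
      also have "\<dots> \<le> (1 + a) * B"
      proof -
        have "(1 + a) * B = B + a / 2 + a * ln A + real k * a" by (simp add: B_def algebra_simps)
        then show ?thesis
          using lnA mult_nonneg_nonneg[OF a lnA] by (simp add: B_def)
      qed
      finally have "\<bar>ln u\<bar> ^ (2 * k) \<le> ((1 + a) * B) ^ (2 * k)" by (intro power_mono) auto
      then have lnu: "ln u ^ (2 * k) \<le> ((1 + a) ^ k)\<^sup>2 * B ^ (2 * k)"
        by (simp add: power_even_abs power_mult_distrib mult.commute flip: power_mult)
      have "M u = u\<^sup>2 * ln u ^ (2 * k)" using d(2) u0 ud by simp
      also have "\<dots> \<le> u\<^sup>2 * (((1 + a) ^ k)\<^sup>2 * B ^ (2 * k))"
        using lnu by (intro mult_left_mono) auto
      also have "\<dots> = m n / A\<^sup>2 * B ^ (2 * k)"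
        unfolding u_def using p a A m(1)[of n]
        by (simp add: power_divide power_mult_distrib less_imp_le add_nonneg_eq_0_iff)
      also have "\<dots> \<le> m n / 1 * B ^ (2 * k)"
        using A m(1)[of n] B by (intro mult_right_mono divide_left_mono) (auto simp: less_imp_le)
      finally have Mu: "M u \<le> B ^ (2 * k) * m n" by (simp add: mult.commute)
      have "M (cmod (F (1/2) n) / (C1 * A * D * N)) = M (cmod (F (1/2) n) / (C1 * A * N) / D)"
        by (simp add: mult_ac)
      also have "\<dots> \<le> M (cmod (F (1/2) n) / (C1 * A * N)) / D"
        using C1 A N D by (intro orlicz_divide_le[OF M]) auto
      also have "\<dots> \<le> M u / D"
        using C1 A N D tu by (intro divide_right_mono orlicz_mono[OF M]) auto
      also have "\<dots> \<le> (B ^ (2 * k) * m n) / D"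
        using Mu D by (intro divide_right_mono) auto
      finally show ?thesis by simp
    qed
    have sm: "summable (\<lambda>n. B ^ (2 * k) / D * m n)" using m(2) by (rule summable_mult)
    have nn: "0 \<le> M (cmod (F (1/2) n) / (C1 * A * D * N))" for n
      using C1 A D N by (intro orlicz_nonneg[OF M]) auto
    have s: "summable (\<lambda>n. M (cmod (F (1/2) n) / (C1 * A * D * N)))"
      by (rule summable_comparison_test'[OF sm, of 0]) (use nn le in auto)
    have "(\<Sum>n. M (cmod (F (1/2) n) / (C1 * A * D * N))) \<le> (\<Sum>n. B ^ (2 * k) / D * m n)"
      by (rule suminf_le[OF le s sm])
    also have "\<dots> = B ^ (2 * k) / D * suminf m" by (rule suminf_mult[OF m(2)])
    also have "\<dots> \<le> B ^ (2 * k) / D * 6" using m(3) D B by (intro mult_left_mono) auto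
    also have "\<dots> \<le> 1" using D by simp
    finally show "C1 * A * D * N \<in> luxemburg M (F (1/2))"
      unfolding luxemburg_def mem_Collect_eq using s mult_pos_pos[OF p N(1)] by blast
  qed
qed

section \<open>Extremal scalar functions\<close>

text \<open>Leibniz with one factor \<open>u\<close> split off: the undifferentiated term dies with
  u z = 0, and every other term has lost both a derivative and a power.\<close>

lemma higher_deriv_mult_power_0:
  fixes u :: "complex \<Rightarrow> complex"
  assumes "u holomorphic_on UNIV" "u z = 0" "g holomorphic_on UNIV" "j < p"
  shows "(deriv ^^ j) (\<lambda>w. g w * u w ^ p) z = 0"
  using assms(3,4)
proof (induction p arbitrary: g j)
  case (Suc p)
  have "(deriv ^^ j) (\<lambda>w. u w * (g w * u w ^ p)) z
      = (\<Sum>i = 0..j. of_nat (j choose i) * (deriv ^^ i) u z * (deriv ^^ (j - i)) (\<lambda>w. g w * u w ^ p) z)"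
    using assms(1) Suc.prems(1)
    by (intro higher_deriv_mult[where S = UNIV]) (auto intro!: holomorphic_intros)
  also have "\<dots> = 0"
  proof (intro sum.neutral ballI)
    fix i assume "i \<in> {0..j}"
    then show "of_nat (j choose i) * (deriv ^^ i) u z * (deriv ^^ (j - i)) (\<lambda>w. g w * u w ^ p) z = 0"
      using assms(2) Suc.IH[OF Suc.prems(1), of "j - i"] Suc.prems(2) by (cases "i = 0") auto
  qed
  finally show ?case by (simp add: algebra_simps)
qed simp

text \<open>The truncated series cancels $e^v$ up to order \<open>k\<close>, so the derivative is a multiple of $v^k$.\<close>

definition flat_exp :: "nat \<Rightarrow> complex \<Rightarrow> complex" where
  "flat_exp k v = exp v * (\<Sum>j\<le>k. (- v) ^ j / fact j)"

text \<open>The sum telescopes: differentiating the power in each new term cancels the remainder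
  left by the previous ones.\<close>

lemma has_field_derivative_flat_exp:
  "(flat_exp k has_field_derivative exp v * (- v) ^ k / fact k) (at v)"
proof (induction k)
  case 0
  have "flat_exp 0 = exp" by (simp add: flat_exp_def fun_eq_iff)
  then show ?case by (simp add: DERIV_exp)
next
  case (Suc k)
  have eq: "flat_exp (Suc k) = (\<lambda>v. flat_exp k v + exp v * ((- v) ^ Suc k / fact (Suc k)))"
    unfolding flat_exp_def sum.atMost_Suc distrib_left ..
  have nz: "(of_nat (Suc k) :: complex) \<noteq> 0" by (simp del: of_nat_Suc)
  have "((\<lambda>v::complex. (- v) ^ Suc k) has_field_derivative of_nat (Suc k) * (- 1 * (- v) ^ k)) (at v)"
  proof -
    have "((\<lambda>v::complex. (- v) ^ Suc k) has_field_derivative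
        of_nat (Suc k) * (- 1 * (- v) ^ (Suc k - Suc 0))) (at v)"
      by (rule DERIV_power[OF DERIV_minus[OF DERIV_ident]])
    then show ?thesis by (simp only: diff_Suc_Suc diff_zero)
  qed
  then have "((\<lambda>v::complex. (- v) ^ Suc k / fact (Suc k)) has_field_derivative
      of_nat (Suc k) * (- 1 * (- v) ^ k) / fact (Suc k)) (at v)"
    by (rule DERIV_cdivide)
  also have "of_nat (Suc k) * (- 1 * (- v) ^ k) / fact (Suc k) = - ((- v) ^ k / fact k)"
    using nz by (simp add: fact_Suc del: of_nat_Suc)
  finally have "((\<lambda>v. flat_exp k v + exp v * ((- v) ^ Suc k / fact (Suc k))) has_field_derivative
      exp v * (- v) ^ k / fact k
        + (exp v * ((- v) ^ Suc k / fact (Suc k)) + - ((- v) ^ k / fact k) * exp v)) (at v)"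
    by (intro DERIV_add[OF Suc.IH] DERIV_mult DERIV_exp)
  moreover have "exp v * (- v) ^ k / fact k
        + (exp v * ((- v) ^ Suc k / fact (Suc k)) + - ((- v) ^ k / fact k) * exp v)
      = exp v * (- v) ^ Suc k / fact (Suc k)"
    by (simp del: fact_Suc power_Suc)
  ultimately show ?case unfolding eq by simp
qed

text \<open>It is $1 + O(w^{2k+2})$ at $0$ and decays like $e^{w^2}$ along the strip.\<close>

definition gauss_cutoff :: "nat \<Rightarrow> complex \<Rightarrow> complex" where
  "gauss_cutoff k w = 1 - (1 - exp (w\<^sup>2)) ^ Suc k"

text \<open>On vertical lines the exponential has the constant modulus exp (c (Re z - 1/2)), so
  \<open>c\<close> shifts size from one boundary line to the other; the cutoff supplies the decay at
  infinity.\<close>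

definition profile :: "nat \<Rightarrow> real \<Rightarrow> complex \<Rightarrow> complex" where
  "profile k c z = flat_exp k (of_real c * (z - 1/2)) * gauss_cutoff k (z - 1/2)"

lemma profile_half: "profile k c (1/2) = 1"
proof -
  have "(\<Sum>j\<le>k. (0::complex) ^ j / fact j) = (\<Sum>j\<le>k. if j = 0 then 1 else 0)"
    by (intro sum.cong) auto
  then show ?thesis by (simp add: profile_def flat_exp_def gauss_cutoff_def)
qed

section \<open>Flatness of the profile at the centre\<close>

lemma holomorphic_flat_exp: "(\<lambda>z. flat_exp k (c * (z - 1/2))) holomorphic_on A"
  unfolding flat_exp_def by (intro holomorphic_intros) auto

lemma holomorphic_gauss_cutoff: "(\<lambda>z. gauss_cutoff k (z - 1/2)) holomorphic_on A"
  unfolding gauss_cutoff_def by (intro holomorphic_intros)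

lemma holomorphic_profile: "profile k c holomorphic_on A"
  unfolding profile_def
  by (intro holomorphic_on_mult holomorphic_flat_exp holomorphic_gauss_cutoff)

text \<open>The first derivative is an entire function times (z - 1/2)^k, so k - 1 further
  derivatives still vanish.\<close>

lemma higher_deriv_flat_exp_half:
  assumes "1 \<le> j" "j \<le> k"
  shows "(deriv ^^ j) (\<lambda>z. flat_exp k (c * (z - 1/2))) (1/2) = 0"
proof -
  obtain i where i: "j = Suc i" "i < k" using assms by (cases j) auto
  have d: "deriv (\<lambda>z. flat_exp k (c * (z - 1/2)))
      = (\<lambda>z. (exp (c * (z - 1/2)) * (- c) ^ k / fact k * c) * (z - 1/2) ^ k)"
  proof
    fix z
    have "((\<lambda>z. flat_exp k (c * (z - 1/2))) has_field_derivative
        (exp (c * (z - 1/2)) * (- (c * (z - 1/2))) ^ k / fact k) * (c * 1)) (at z)"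
      by (rule DERIV_chain'[OF _ has_field_derivative_flat_exp]) (auto intro!: derivative_eq_intros)
    moreover have "(- (c * (z - 1/2))) ^ k = (- c) ^ k * (z - 1/2) ^ k"
      by (metis mult_minus_left power_mult_distrib)
    ultimately show "deriv (\<lambda>z. flat_exp k (c * (z - 1/2))) z
        = (exp (c * (z - 1/2)) * (- c) ^ k / fact k * c) * (z - 1/2) ^ k"
      by (simp add: DERIV_imp_deriv mult_ac)
  qed
  have "(deriv ^^ i) (\<lambda>z. (exp (c * (z - 1/2)) * (- c) ^ k / fact k * c) * (z - 1/2) ^ k) (1/2) = 0"
    by (rule higher_deriv_mult_power_0) (auto intro!: holomorphic_intros i(2))
  then show ?thesis unfolding i(1) funpow_Suc_right o_def d .
qed

lemma higher_deriv_gauss_cutoff_half: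
  assumes "1 \<le> j" "j \<le> k"
  shows "(deriv ^^ j) (\<lambda>z. gauss_cutoff k (z - 1/2)) (1/2) = 0"
proof -
  let ?u = "\<lambda>z::complex. 1 - exp ((z - 1/2)\<^sup>2)"
  have "(deriv ^^ j) (\<lambda>z. 1 - 1 * ?u z ^ Suc k) (1/2)
      = (deriv ^^ j) (\<lambda>z. 1) (1/2) - (deriv ^^ j) (\<lambda>z. 1 * ?u z ^ Suc k) (1/2)"
    by (rule higher_deriv_diff[where S = UNIV]) (auto intro!: holomorphic_intros)
  also have "(deriv ^^ j) (\<lambda>z. 1 * ?u z ^ Suc k) (1/2) = 0"
    by (rule higher_deriv_mult_power_0) (use assms in \<open>auto intro!: holomorphic_intros\<close>)
  finally show ?thesis using assms by (simp add: gauss_cutoff_def)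
qed

lemma higher_deriv_profile_half:
  assumes "1 \<le> j" "j \<le> k"
  shows "(deriv ^^ j) (profile k c) (1/2) = 0"
proof -
  let ?E = "\<lambda>z. flat_exp k (of_real c * (z - 1/2))" and ?g = "\<lambda>z. gauss_cutoff k (z - 1/2)"
  have "(deriv ^^ j) (\<lambda>z. ?E z * ?g z) (1/2)
      = (\<Sum>i = 0..j. of_nat (j choose i) * (deriv ^^ i) ?E (1/2) * (deriv ^^ (j - i)) ?g (1/2))"
    by (rule higher_deriv_mult[OF holomorphic_flat_exp holomorphic_gauss_cutoff, where S = UNIV]) auto
  also have "\<dots> = 0"
  proof (intro sum.neutral ballI)
    fix i assume "i \<in> {0..j}"
    then show "of_nat (j choose i) * (deriv ^^ i) ?E (1/2) * (deriv ^^ (j - i)) ?g (1/2) = 0"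
      using assms higher_deriv_flat_exp_half[of i k "of_real c"] higher_deriv_gauss_cutoff_half[of j k]
      by (cases "i = 0") auto
  qed
  finally show ?thesis by (simp add: profile_def[abs_def])
qed

text \<open>The factors bound the pieces of \<open>profile\<close>: 2 exp (-y^2) for exp (w^2), Suc
  k * 3^k for the geometric sum in the cutoff, exp (1 + 2 |y|) for the Taylor polynomial.\<close>

definition decay :: "nat \<Rightarrow> real \<Rightarrow> real" where
  "decay k y = 2 * real (Suc k) * 3 ^ k * exp (1 + 2 * \<bar>y\<bar> - y\<^sup>2)"

lemma decay_nonneg: "0 \<le> decay k y"
  by (simp add: decay_def)

lemma decay_le: "decay k y \<le> 2 * real (Suc k) * 3 ^ k * exp 2"
proof -
  have "0 \<le> (\<bar>y\<bar> - 1)\<^sup>2" by simp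
  then have "1 + 2 * \<bar>y\<bar> - y\<^sup>2 \<le> 2" by (simp add: power2_diff)
  then show ?thesis unfolding decay_def by (intro mult_left_mono) auto
qed

lemma decay_tendsto_0: "(decay k \<longlongrightarrow> 0) at_infinity"
proof -
  have "((\<lambda>y::real. exp (1 + 2 * \<bar>y\<bar> - y\<^sup>2)) \<longlongrightarrow> 0) at_top"
    "((\<lambda>y::real. exp (1 + 2 * \<bar>y\<bar> - y\<^sup>2)) \<longlongrightarrow> 0) at_bot"
    by real_asymp+
  then have "((\<lambda>y::real. exp (1 + 2 * \<bar>y\<bar> - y\<^sup>2)) \<longlongrightarrow> 0) at_infinity"
    by (simp add: at_infinity_eq_at_top_bot filterlim_sup)
  then show ?thesis unfolding decay_def[abs_def] by (rule tendsto_mult_right_zero)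
qed

lemma sum_power_fact_le_exp:
  assumes "0 \<le> (x::real)"
  shows "(\<Sum>j\<le>k. x ^ j / fact j) \<le> exp x"
proof -
  have "summable (\<lambda>j. x ^ j /\<^sub>R fact j)" by (rule summable_exp_generic)
  then have "(\<Sum>j\<le>k. x ^ j /\<^sub>R fact j) \<le> (\<Sum>j. x ^ j /\<^sub>R fact j)"
    using assms by (intro sum_le_suminf) auto
  then show ?thesis by (simp add: exp_def divide_inverse_commute)
qed

lemma norm_profile_le:
  assumes z: "z \<in> strip" and c: "\<bar>c\<bar> \<le> 2 * l" and l: "1 \<le> l"
  shows "cmod (profile k c z) \<le> exp (c * (Re z - 1/2)) * l ^ k * decay k (Im z)"
proof -
  define w where "w = z - 1/2"
  define y where "y = Im z"
  have rew: "\<bar>Re w\<bar> \<le> 1/2"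
  proof -
    have "Re w = Re z - 1/2" "0 \<le> Re z" "Re z \<le> 1" using z by (auto simp: w_def strip_def)
    then show ?thesis by linarith
  qed
  have imw: "Im w = y" by (simp add: w_def y_def)
  have normw: "cmod w \<le> 1/2 + \<bar>y\<bar>" using cmod_le[of w] rew imw by linarith
  \<comment> \<open>As l >= 1, all dependence on \<open>c\<close> is absorbed into the single factor
    l^k; what remains is a partial sum of exp (2 |w|).\<close>
  have "cmod (\<Sum>j\<le>k. (- (of_real c * w)) ^ j / fact j) \<le> (\<Sum>j\<le>k. l ^ k * ((2 * cmod w) ^ j / fact j))"
  proof (rule sum_norm_le)
    fix j assume j: "j \<in> {..k}"
    have "cmod ((- (of_real c * w)) ^ j / fact j) = (\<bar>c\<bar> * cmod w) ^ j / fact j"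
      by (simp add: norm_divide norm_power norm_mult)
    also have "\<dots> \<le> (2 * l * cmod w) ^ j / fact j"
      using c by (intro divide_right_mono power_mono mult_right_mono) auto
    also have "\<dots> = l ^ j * ((2 * cmod w) ^ j / fact j)" by (simp add: power_mult_distrib)
    also have "\<dots> \<le> l ^ k * ((2 * cmod w) ^ j / fact j)"
      using j l by (intro mult_right_mono power_increasing) auto
    finally show "cmod ((- (of_real c * w)) ^ j / fact j) \<le> l ^ k * ((2 * cmod w) ^ j / fact j)" .
  qed
  also have "\<dots> = l ^ k * (\<Sum>j\<le>k. (2 * cmod w) ^ j / fact j)" by (simp add: sum_distrib_left)
  also have "\<dots> \<le> l ^ k * exp (2 * cmod w)"
    using l by (intro mult_left_mono sum_power_fact_le_exp) auto
  also have "\<dots> \<le> l ^ k * exp (1 + 2 * \<bar>y\<bar>)"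
    using normw l by (intro mult_left_mono) auto
  finally have P: "cmod (\<Sum>j\<le>k. (- (of_real c * w)) ^ j / fact j) \<le> l ^ k * exp (1 + 2 * \<bar>y\<bar>)" .
  have ex: "cmod (exp (of_real c * w)) = exp (c * (Re z - 1/2))" by (simp add: w_def)
  define q where "q = exp (w\<^sup>2)"
  have "(Re w)\<^sup>2 \<le> (1/2)\<^sup>2" using rew by (intro abs_le_square_iff[THEN iffD1]) auto
  then have "Re (w\<^sup>2) \<le> 1/4 - y\<^sup>2" by (simp add: power2_eq_square imw)
  then have "cmod q \<le> exp (1/4 - y\<^sup>2)" by (simp add: q_def)
  also have "\<dots> = exp (1/4) * exp (- (y\<^sup>2))" by (simp flip: exp_add)
  also have "\<dots> \<le> 2 * exp (- (y\<^sup>2))"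
  proof (intro mult_right_mono)
    have "exp (1/4 :: real) \<le> 1 + 1/4 + (1/4)\<^sup>2" by (rule exp_bound) auto
    then show "exp (1/4 :: real) \<le> 2" by (simp add: power2_eq_square)
  qed auto
  finally have q: "cmod q \<le> 2 * exp (- (y\<^sup>2))" .
  moreover have "exp (- (y\<^sup>2)) \<le> 1" by simp
  ultimately have "cmod q \<le> 2" by linarith
  then have q1: "cmod (1 - q) \<le> 3" using norm_triangle_ineq4[of 1 q] by simp
  have "cmod (\<Sum>i<Suc k. (1 - q) ^ i) \<le> (\<Sum>i<Suc k. 3 ^ k)"
  proof (rule sum_norm_le)
    fix i assume i: "i \<in> {..<Suc k}"
    have "cmod ((1 - q) ^ i) \<le> 3 ^ i" using q1 by (simp add: norm_power power_mono)
    also have "\<dots> \<le> 3 ^ k" using i by (intro power_increasing) auto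
    finally show "cmod ((1 - q) ^ i) \<le> 3 ^ k" .
  qed
  then have S: "cmod (\<Sum>i<Suc k. (1 - q) ^ i) \<le> real (Suc k) * 3 ^ k" by simp
  \<comment> \<open>Writing the cutoff as a multiple of q = exp (w^2) exhibits its decay, which the
    triangle inequality applied to the definition would lose.\<close>
  have "gauss_cutoff k w = q * (\<Sum>i<Suc k. (1 - q) ^ i)"
    using one_diff_power_eq[of "1 - q" "Suc k"] by (simp add: gauss_cutoff_def q_def)
  then have "cmod (gauss_cutoff k w) = cmod q * cmod (\<Sum>i<Suc k. (1 - q) ^ i)"
    by (simp add: norm_mult)
  also have "\<dots> \<le> (2 * exp (- (y\<^sup>2))) * (real (Suc k) * 3 ^ k)"
    using q S by (intro mult_mono) auto
  finally have G: "cmod (gauss_cutoff k w) \<le> (2 * exp (- (y\<^sup>2))) * (real (Suc k) * 3 ^ k)" .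
  have "cmod (profile k c z) = cmod (exp (of_real c * w))
      * (cmod (\<Sum>j\<le>k. (- (of_real c * w)) ^ j / fact j) * cmod (gauss_cutoff k w))"
    by (simp add: profile_def flat_exp_def norm_mult w_def)
  also have "\<dots> \<le> exp (c * (Re z - 1/2))
      * ((l ^ k * exp (1 + 2 * \<bar>y\<bar>)) * ((2 * exp (- (y\<^sup>2))) * (real (Suc k) * 3 ^ k)))"
    unfolding ex using P G l by (intro mult_left_mono mult_mono) auto
  also have "\<dots> = exp (c * (Re z - 1/2)) * l ^ k * (2 * real (Suc k) * 3 ^ k
      * (exp (1 + 2 * \<bar>y\<bar>) * exp (- (y\<^sup>2))))"
    by (simp only: mult_ac)
  also have "exp (1 + 2 * \<bar>y\<bar>) * exp (- (y\<^sup>2)) = exp (1 + 2 * \<bar>y\<bar> - y\<^sup>2)"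
    by (simp flip: exp_add)
  finally show ?thesis by (simp add: decay_def y_def)
qed

text \<open>The parameter \<open>s\<close> perturbs the extremal choice \<open>s = 1\<close>: letting it tend to $0$ along the coordinates
  makes the resulting sequence of functions norm continuous up to the boundary, while \<open>L\<^sup>2 / s\<close> must
  stay summable.\<close>

lemma extremal_bounds:
  fixes t s :: real and k :: nat
  defines "L \<equiv> t * (- ln t) ^ k"
  assumes t: "0 < t" "t \<le> exp (-1)" and s: "L \<le> s" "s \<le> 1" and z: "z \<in> strip"
  shows "t * cmod (profile k (2 * ln (L / s)) z) \<le> s * decay k (Im z)"
    and "Re z = 1 \<Longrightarrow> t * cmod (profile k (2 * ln (L / s)) z) \<le> L\<^sup>2 / s * decay k (Im z)"
proof -
  define l where "l = - ln t"
  \<comment> \<open>With this \<open>c\<close>, exp (c (Re z - 1/2)) equals s / L on the left line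
    and L / s on the right one; multiplied by L = t l^k these give s and L^2 / s.\<close>
  define c where "c = 2 * ln (L / s)"
  have "ln t \<le> -1" using t by (metis exp_gt_zero ln_exp ln_le_cancel_iff)
  then have l: "1 \<le> l" by (simp add: l_def)
  have L: "0 < L" unfolding L_def l_def[symmetric] using t l by (intro mult_pos_pos zero_less_power) auto
  have s0: "0 < s" using L s by linarith
  have ratio: "0 < L / s" "L / s \<le> 1" using L s s0 by auto
  have c0: "c \<le> 0" using ratio by (simp add: c_def)
  have lnL: "ln L = - l + real k * ln l"
    unfolding L_def using t l by (simp add: ln_mult ln_realpow l_def)
  \<comment> \<open>From s <= 1 follows c >= 2 ln L, and l >= 1 gives ln L >= -l; hence -2 l <= c <=
    0, as \<open>norm_profile_le\<close> requires.\<close>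
  have "ln s \<le> 0" using s s0 by simp
  moreover have "0 \<le> real k * ln l" using l by simp
  moreover have "c = 2 * ln L - 2 * ln s" using L s0 by (simp add: c_def ln_div)
  ultimately have cl: "\<bar>c\<bar> \<le> 2 * l" using c0 lnL by linarith
  have half: "exp (- (c / 2)) = s / L"
    using ratio L s0 by (simp add: c_def exp_minus)
  have "t * cmod (profile k c z) \<le> t * (exp (c * (Re z - 1/2)) * l ^ k * decay k (Im z))"
    using t norm_profile_le[OF z cl l, of k] by (intro mult_left_mono) auto
  also have "\<dots> = L * exp (c * Re z) * exp (- (c / 2)) * decay k (Im z)"
    by (simp add: L_def l_def algebra_simps flip: exp_add)
  also have "\<dots> = s * exp (c * Re z) * decay k (Im z)" unfolding half using L by simp
  finally have main: "t * cmod (profile k c z) \<le> s * exp (c * Re z) * decay k (Im z)" .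
  have "c * Re z \<le> 0" using c0 z by (intro mult_nonpos_nonneg) (auto simp: strip_def)
  then have "s * exp (c * Re z) * decay k (Im z) \<le> s * 1 * decay k (Im z)"
    using s0 decay_nonneg by (intro mult_right_mono mult_left_mono) auto
  with main show "t * cmod (profile k (2 * ln (L / s)) z) \<le> s * decay k (Im z)"
    by (simp add: c_def)
  have "exp c = (L / s)\<^sup>2" using ratio by (simp add: c_def power2_eq_square exp_double exp_ln)
  then have "s * exp c = L\<^sup>2 / s" using s0 by (simp add: power_divide power2_eq_square)
  with main show "t * cmod (profile k (2 * ln (L / s)) z) \<le> L\<^sup>2 / s * decay k (Im z)" if "Re z = 1"
    using that by (simp add: c_def)
qed

text \<open>\<open>s n\<close> is the square root of the n-th tail of the series. Then m_n = s_n^2 -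
  s_(n+1)^2 <= 2 s_n (s_n - s_(n+1)), so the quotients m_n / s_n are dominated by a telescoping
  series.\<close>

lemma tail_weights:
  fixes m :: "nat \<Rightarrow> real"
  assumes m: "\<And>n. 0 \<le> m n" "summable m" "suminf m \<le> 1"
  obtains s where "s \<longlonglongrightarrow> 0" "\<And>n. 0 \<le> s n" "\<And>n. s n \<le> 1" "\<And>n. m n \<le> (s n)\<^sup>2"
    "summable (\<lambda>n. m n / s n)" "(\<Sum>n. m n / s n) \<le> 2"
proof -
  define r where "r n = suminf m - (\<Sum>i<n. m i)" for n
  define s where "s n = sqrt (r n)" for n
  have r0: "0 \<le> r n" for n
    unfolding r_def using sum_le_suminf[OF m(2), of "{..<n}"] m(1) by simp
  have step: "r n = m n + r (Suc n)" for n by (simp add: r_def)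
  have mr: "m n \<le> r n" for n using step[of n] r0[of "Suc n"] by linarith
  have anti: "r (Suc n) \<le> r n" for n using step[of n] m(1)[of n] by linarith
  have r1: "r n \<le> 1" for n unfolding r_def using m(3) sum_nonneg[of "{..<n}" m] m(1) by simp
  have "(\<lambda>n. suminf m - (\<Sum>i<n. m i)) \<longlonglongrightarrow> suminf m - suminf m"
    by (intro tendsto_intros summable_LIMSEQ m(2))
  then have "r \<longlonglongrightarrow> 0" by (simp add: r_def[abs_def])
  then have s_lim: "s \<longlonglongrightarrow> 0" unfolding s_def[abs_def] using tendsto_real_sqrt by fastforce
  have s0: "0 \<le> s n" for n by (simp add: s_def r0)
  have s1: "s n \<le> 1" for n by (simp add: s_def r1)
  have sq: "(s n)\<^sup>2 = r n" for n by (simp add: s_def r0)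
  have le: "m n / s n \<le> 2 * (s n - s (Suc n))" for n
  proof (cases "s n = 0")
    \<comment> \<open>The tail is 0, hence so is \<open>m n\<close>, and division by 0 yields the
      harmless value 0.\<close>
    case True
    then have "s (Suc n) = 0" using anti[of n] r0[of "Suc n"] by (simp add: s_def)
    with True show ?thesis by simp
  next
    case False
    then have p: "0 < s n" using s0[of n] by simp
    have mono: "s (Suc n) \<le> s n" by (simp add: s_def anti)
    have "m n = (s n - s (Suc n)) * (s n + s (Suc n))"
      using step[of n] sq[of n] sq[of "Suc n"] by (simp add: power2_eq_square algebra_simps)
    also have "\<dots> \<le> (s n - s (Suc n)) * (s n + s n)" using mono by (intro mult_left_mono) auto
    also have "\<dots> = 2 * (s n - s (Suc n)) * s n" by simp
    finally show ?thesis using p by (simp add: pos_divide_le_eq)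
  qed
  have part: "(\<Sum>n<K. m n / s n) \<le> 2" for K
  proof -
    have "(\<Sum>n<K. m n / s n) \<le> (\<Sum>n<K. 2 * (s n - s (Suc n)))" by (intro sum_mono le)
    also have "\<dots> = 2 * (s 0 - s K)" unfolding sum_distrib_left[symmetric] by (simp add: sum_lessThan_telescope')
    also have "2 * (s 0 - s K) \<le> 2" using s0[of K] s1[of 0] by simp
    finally show ?thesis .
  qed
  have nn: "0 \<le> m n / s n" for n using m(1) s0 by simp
  have "summable (\<lambda>n. m n / s n)" using nn part by (rule summableI_nonneg_bounded)
  moreover from this have "(\<Sum>n. m n / s n) \<le> 2" using part by (rule suminf_le_const)
  ultimately show thesis using s_lim s0 s1 mr sq by (intro that[of s]) auto
qed

section \<open>Equality of the spaces\<close>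

lemma Delta_0: "Delta 0 F = F (1/2)"
  by (simp add: Delta_def fun_eq_iff)

text \<open>The preimage is explicit: coordinate \<open>n\<close> is x_n times a
  \<open>profile\<close> whose \<open>c\<close> balances the boundary lines through the weights of
  \<open>tail_weights\<close> for the modular of the rescaled sequence.\<close>

lemma orlicz_imp_kernel:
  assumes M: "orlicz_function M" and near0: "\<forall>\<^sub>F t in at_right 0. M t = t\<^sup>2 * ln t ^ (2 * k)"
  shows "\<exists>C>0. \<forall>x. \<forall>\<rho>\<in>luxemburg M x. \<exists>F\<in>kernel_Delta k. Delta 0 F = x \<and> calderon_norm F \<le> C * \<rho>"
proof -
  obtain d where d: "0 < d" "\<And>t. 0 \<le> t \<Longrightarrow> t < d \<Longrightarrow> M t = t\<^sup>2 * ln t ^ (2 * k)"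
    using orlicz_near_0[OF M near0] by blast
  have "filterlim M at_top at_top" using M by (simp add: orlicz_function_def)
  then have "eventually (\<lambda>t. 2 \<le> M t) at_top" by (simp add: filterlim_at_top)
  then obtain R0 where R0: "\<And>t. R0 \<le> t \<Longrightarrow> 2 \<le> M t" by (auto simp: eventually_at_top_linorder)
  \<comment> \<open>Beyond \<open>R1\<close> the function is at least 2, so a modular of at most 1
    confines every |x_n| / \<rho> to [0, R1].\<close>
  define R1 where "R1 = max 1 R0"
  have R1: "1 \<le> R1" by (simp add: R1_def)
  have small: "t \<le> R1" if "M t \<le> 1" for t
  proof (rule ccontr)
    assume "\<not> t \<le> R1"
    then have "R0 \<le> t" by (simp add: R1_def)
    then show False using R0[of t] that by linarith
  qed
  \<comment> \<open>Below \<open>d\<close> the formula for \<open>M\<close> holds; below 1/e one has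
    -ln t >= 1, as \<open>extremal_bounds\<close> needs.\<close>
  define e where "e = min (d / 2) (exp (-1))"
  have e: "0 < e" "e < d" "e \<le> exp (-1)" using d(1) by (auto simp: e_def)
  have e1: "e \<le> 1" using e(3) by (rule order_trans) simp
  define K where "K = 2 * real (Suc k) * 3 ^ k * exp 2"
  have K: "0 < K" unfolding K_def by (intro mult_pos_pos) auto
  show ?thesis
  proof (intro exI[of _ "2 * (R1 / e) * K"] conjI ballI allI impI)
    show "0 < 2 * (R1 / e) * K" using R1 e K by (intro mult_pos_pos divide_pos_pos) auto
    fix x :: cseq and \<rho> :: real
    assume "\<rho> \<in> luxemburg M x"
    then have \<rho>: "0 < \<rho>" and sx: "summable (\<lambda>n. M (cmod (x n) / \<rho>))"
      and x1: "(\<Sum>n. M (cmod (x n) / \<rho>)) \<le> 1"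
      unfolding luxemburg_def by blast+
    \<comment> \<open>The factor \<open>R1 / e\<close> moves all coordinates from [0, R1] into
      [0, e]. The final constant combines it with the 2 of \<open>tail_weights\<close> and the bound
      \<open>K\<close> for \<open>decay\<close>.\<close>
    define R where "R = R1 / e * \<rho>"
    have R: "0 < R" unfolding R_def using R1 e \<rho> by (intro mult_pos_pos divide_pos_pos) auto
    define t where "t n = cmod (x n) / R" for n
    have t0: "0 \<le> t n" for n using R by (simp add: t_def)
    have xt: "cmod (x n) = R * t n" for n using R by (simp add: t_def)
    have nn: "0 \<le> M (cmod (x n) / \<rho>)" for n using \<rho> by (intro orlicz_nonneg[OF M]) auto
    have te: "t n = (cmod (x n) / \<rho>) * (e / R1)" for n
      using R1 e \<rho> by (simp add: t_def R_def)
    have "sum (\<lambda>n. M (cmod (x n) / \<rho>)) {n} \<le> (\<Sum>n. M (cmod (x n) / \<rho>))" for n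
      using nn by (intro sum_le_suminf sx) auto
    then have "M (cmod (x n) / \<rho>) \<le> 1" for n using x1 order_trans by fastforce
    then have bd: "cmod (x n) / \<rho> \<le> R1" for n by (rule small)
    have t_e: "t n \<le> e" for n
    proof -
      have "t n \<le> R1 * (e / R1)"
        unfolding te using R1 e by (intro mult_right_mono bd) auto
      then show ?thesis using R1 by simp
    qed
    have "t n \<le> cmod (x n) / \<rho>" for n
    proof -
      have "e / R1 \<le> 1" using e1 R1 by (simp add: pos_divide_le_eq)
      then have "(cmod (x n) / \<rho>) * (e / R1) \<le> (cmod (x n) / \<rho>) * 1"
        using \<rho> by (intro mult_left_mono) auto
      then show ?thesis unfolding te by simp
    qed
    then have Mt_le: "M (t n) \<le> M (cmod (x n) / \<rho>)" for n by (intro orlicz_mono[OF M] t0)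
    define m where "m n = M (t n)" for n
    have m0: "0 \<le> m n" for n unfolding m_def by (intro orlicz_nonneg[OF M] t0)
    have sm: "summable m"
    proof (rule summable_comparison_test'[OF sx, of 0])
      show "norm (m n) \<le> M (cmod (x n) / \<rho>)" for n
        using m0[of n] Mt_le[of n] by (simp add: m_def)
    qed
    have "suminf m \<le> (\<Sum>n. M (cmod (x n) / \<rho>))"
      by (rule suminf_le[OF _ sm sx]) (simp add: m_def Mt_le)
    then have m1: "suminf m \<le> 1" using x1 by linarith
    obtain s where s: "s \<longlonglongrightarrow> 0" "\<And>n. 0 \<le> s n" "\<And>n. s n \<le> 1" "\<And>n. m n \<le> (s n)\<^sup>2"
      "summable (\<lambda>n. m n / s n)" "(\<Sum>n. m n / s n) \<le> 2"
      using tail_weights[OF m0 sm m1] by blast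
    \<comment> \<open>Its square is the n-th term of the modular, which is how the Orlicz function
      meets the extremal bounds.\<close>
    define L where "L n = t n * (- ln (t n)) ^ k" for n
    have mL: "m n = (L n)\<^sup>2" for n
    proof -
      have "m n = (t n)\<^sup>2 * ln (t n) ^ (2 * k)"
        unfolding m_def using d(2) t0 t_e e(2) le_less_trans by blast
      also have "ln (t n) ^ (2 * k) = ((- ln (t n)) ^ k)\<^sup>2"
        by (simp add: power_mult[symmetric] mult.commute)
      finally show ?thesis by (simp add: L_def power_mult_distrib)
    qed
    have Ls: "L n \<le> s n" for n
      using s(2,4)[of n] mL[of n] by (metis power2_le_imp_le)
    define F where "F z n = x n * profile k (2 * ln (L n / s n)) z" for z n
    have bound: "cmod (F z n) \<le> R * s n * decay k (Im z)"
      and bound1: "Re z = 1 \<Longrightarrow> cmod (F z n) \<le> R * (m n / s n) * decay k (Im z)"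
      if z: "z \<in> strip" for z n
    proof -
      have eq: "cmod (F z n) = R * (t n * cmod (profile k (2 * ln (L n / s n)) z))"
        by (simp add: F_def norm_mult xt)
      have "cmod (F z n) \<le> R * s n * decay k (Im z) \<and>
        (Re z = 1 \<longrightarrow> cmod (F z n) \<le> R * (m n / s n) * decay k (Im z))"
      proof (cases "t n = 0")
        \<comment> \<open>Here x n = 0, whatever value the conventions for \<open>ln\<close> and
          division give to \<open>c\<close>.\<close>
        case True
        then show ?thesis unfolding eq using R s(2)[of n] m0[of n] decay_nonneg by simp
      next
        case False
        then have t: "0 < t n" "t n \<le> exp (-1)" using t0[of n] t_e[of n] e(3) by auto
        note eb = extremal_bounds[OF t Ls[of n, unfolded L_def] s(3)[of n] z, folded L_def]
        show ?thesis unfolding eq mult.assoc mL using R by (intro conjI impI mult_left_mono eb) auto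
      qed
      then show "cmod (F z n) \<le> R * s n * decay k (Im z)"
        and "Re z = 1 \<Longrightarrow> cmod (F z n) \<le> R * (m n / s n) * decay k (Im z)" by auto
    qed
    have hol: "(\<lambda>z. F z n) holomorphic_on A" for n A
      unfolding F_def by (intro holomorphic_intros holomorphic_profile)
    have cal: "F \<in> calderon \<and> calderon_norm F \<le> max R (\<Sum>n. R * (m n / s n)) * K"
    proof (rule calderonI[where F = F and s = "\<lambda>n. R * s n" and S = R and \<kappa> = "decay k" and K = K
          and r = "\<lambda>n. R * (m n / s n)"])
      show "continuous_on strip (\<lambda>z. F z n)" for n
        by (rule holomorphic_on_imp_continuous_on[OF hol])
      show "(\<lambda>z. F z n) holomorphic_on open_strip" for n by (rule hol)
      show "cmod (F z n) \<le> R * s n * decay k (Im z)" if "z \<in> strip" for z n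
        by (rule bound[OF that])
      show "(\<lambda>n. R * s n) \<longlonglongrightarrow> 0" by (rule tendsto_mult_right_zero[OF s(1)])
      show "0 \<le> R * s n" for n using R s(2)[of n] by simp
      show "R * s n \<le> R" for n using R s(3)[of n] by (simp add: mult_left_le)
      show "(decay k \<longlongrightarrow> 0) at_infinity" by (rule decay_tendsto_0)
      show "0 \<le> decay k y" for y by (rule decay_nonneg)
      show "decay k y \<le> K" for y unfolding K_def by (rule decay_le)
      show "cmod (F (Complex 1 y) n) \<le> R * (m n / s n) * decay k y" for y n
        using bound1[of "Complex 1 y" n] by (simp add: strip_def)
      show "summable (\<lambda>n. R * (m n / s n))" by (rule summable_mult[OF s(5)])
      show "0 \<le> R * (m n / s n)" for n using R m0[of n] s(2)[of n] by simp
    qed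
    have "(\<Sum>n. R * (m n / s n)) = R * (\<Sum>n. m n / s n)" by (rule suminf_mult[OF s(5)])
    also have "\<dots> \<le> R * 2" using s(6) R by (intro mult_left_mono) auto
    finally have "max R (\<Sum>n. R * (m n / s n)) * K \<le> (R * 2) * K"
      using R K by (intro mult_right_mono) auto
    then have norm: "calderon_norm F \<le> 2 * (R1 / e) * K * \<rho>"
      using cal by (simp add: R_def mult_ac)
    have flat: "(deriv ^^ j) (\<lambda>z. F z n) (1/2) = 0" if "1 \<le> j" "j \<le> k" for j n
    proof -
      have "(deriv ^^ j) (\<lambda>z. F z n) (1/2) = x n * (deriv ^^ j) (profile k (2 * ln (L n / s n))) (1/2)"
        unfolding F_def by (rule higher_deriv_cmult[OF holomorphic_profile[of _ _ UNIV]]) auto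
      then show ?thesis using higher_deriv_profile_half[OF that] by simp
    qed
    have "F \<in> kernel_Delta k"
      unfolding kernel_Delta_def using cal flat by (auto simp: Delta_eq)
    moreover have "Delta 0 F = x" by (simp add: Delta_0 F_def fun_eq_iff profile_half)
    ultimately show "\<exists>F\<in>kernel_Delta k. Delta 0 F = x \<and> calderon_norm F \<le> 2 * (R1 / e) * K * \<rho>"
      using norm by blast
  qed
qed

section \<open>Comparison of the two norms\<close>

lemma orlicz_norm_eq: "orlicz_norm M x = Inf (luxemburg M x)"
  by (simp add: orlicz_norm_def luxemburg_def)

text \<open>\<open>orlicz_space\<close> provides only a finite modular S; enlarging the scale by max
  1 S brings it below 1 by convexity.\<close>

lemma luxemburg_nonempty:
  assumes M: "orlicz_function M" and x: "x \<in> orlicz_space M"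
  shows "\<exists>\<rho>. \<rho> \<in> luxemburg M x"
proof -
  obtain r where r: "0 < r" "summable (\<lambda>n. M (cmod (x n) / r))"
    using x unfolding orlicz_space_def by auto
  define S where "S = (\<Sum>n. M (cmod (x n) / r))"
  define A where "A = max 1 S"
  have A: "1 \<le> A" "S \<le> A" by (auto simp: A_def)
  have le: "M (cmod (x n) / (r * A)) \<le> M (cmod (x n) / r) / A" for n
    using orlicz_divide_le[OF M, of "cmod (x n) / r" A] A r by simp
  have nn: "0 \<le> M (cmod (x n) / (r * A))" for n
    using r A by (intro orlicz_nonneg[OF M]) auto
  have sA: "summable (\<lambda>n. M (cmod (x n) / r) / A)" by (rule summable_divide[OF r(2)])
  have s: "summable (\<lambda>n. M (cmod (x n) / (r * A)))"
  proof (rule summable_comparison_test'[OF sA, of 0])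
    show "norm (M (cmod (x n) / (r * A))) \<le> M (cmod (x n) / r) / A" for n
      using le[of n] nn[of n] by simp
  qed
  have "(\<Sum>n. M (cmod (x n) / (r * A))) \<le> (\<Sum>n. M (cmod (x n) / r) / A)"
    by (rule suminf_le[OF le s sA])
  also have "\<dots> = S / A" unfolding S_def by (rule suminf_divide[OF r(2)])
  also have "\<dots> \<le> 1" using A by (simp add: pos_divide_le_eq)
  finally have "r * A \<in> luxemburg M x" using s r A by (simp add: luxemburg_def)
  then show ?thesis ..
qed

text \<open>The transfers between functions and admissible scales hold with constants independent of
  the sequence, so they survive the passage to infima on both sides.\<close>

theorem kernel_Delta_orlicz:
  assumes M: "orlicz_function M" and near0: "\<forall>\<^sub>F t in at_right 0. M t = t\<^sup>2 * ln t ^ (2 * k)"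
  shows "equal_with_equivalent_norms
           (Delta 0 ` kernel_Delta k) (quotient_norm (Delta 0) (kernel_Delta k))
           (orlicz_space M) (orlicz_norm M)"
proof -
  obtain C where C: "0 < C"
    and lower: "\<forall>F\<in>kernel_Delta k. \<forall>N>0. calderon_norm F \<le> N \<longrightarrow> C * N \<in> luxemburg M (F (1/2))"
    using kernel_imp_orlicz[OF M near0] by blast
  obtain D where D: "0 < D"
    and upper: "\<forall>x. \<forall>\<rho>\<in>luxemburg M x. \<exists>F\<in>kernel_Delta k. Delta 0 F = x \<and> calderon_norm F \<le> D * \<rho>"
    using orlicz_imp_kernel[OF M near0] by blast
  let ?Q = "\<lambda>x. {calderon_norm F | F. F \<in> kernel_Delta k \<and> Delta 0 F = x}"
  have cal0: "0 \<le> calderon_norm F" if "F \<in> kernel_Delta k" for F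
    using that calderon_norm_nonneg by (simp add: kernel_Delta_def)
  have sub: "C * N \<in> luxemburg M (Delta 0 F)" if "F \<in> kernel_Delta k" "0 < N" "calderon_norm F \<le> N" for F N
    using lower that by (simp add: Delta_0)
  have X: "Delta 0 ` kernel_Delta k = orlicz_space M"
  proof
    show "Delta 0 ` kernel_Delta k \<subseteq> orlicz_space M"
    proof
      fix x assume "x \<in> Delta 0 ` kernel_Delta k"
      then obtain F where F: "F \<in> kernel_Delta k" "x = Delta 0 F" by blast
      \<comment> \<open>The summand 1 keeps the bound positive when the norm is 0.\<close>
      have "C * (calderon_norm F + 1) \<in> luxemburg M x"
        unfolding F(2) using cal0[OF F(1)] by (intro sub F(1)) auto
      then show "x \<in> orlicz_space M" unfolding orlicz_space_def luxemburg_def by blast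
    qed
    show "orlicz_space M \<subseteq> Delta 0 ` kernel_Delta k"
    proof
      fix x assume "x \<in> orlicz_space M"
      then obtain \<rho> where "\<rho> \<in> luxemburg M x" using luxemburg_nonempty[OF M] by blast
      then obtain F where "F \<in> kernel_Delta k" "Delta 0 F = x" using upper by blast
      then show "x \<in> Delta 0 ` kernel_Delta k" by blast
    qed
  qed
  have lowerN: "(1 / C) * orlicz_norm M x \<le> quotient_norm (Delta 0) (kernel_Delta k) x"
    if x: "x \<in> Delta 0 ` kernel_Delta k" for x
    unfolding quotient_norm_def
  proof (rule cInf_greatest)
    show "?Q x \<noteq> {}" using x by blast
    fix q assume "q \<in> ?Q x"
    then obtain F where F: "q = calderon_norm F" "F \<in> kernel_Delta k" "Delta 0 F = x" by blast
    have "orlicz_norm M x / C \<le> q"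
    \<comment> \<open>Scales must be positive, and q may be 0; hence q + \<epsilon>.\<close>
    proof (rule field_le_epsilon)
      fix \<epsilon> :: real assume \<epsilon>: "0 < \<epsilon>"
      have "C * (q + \<epsilon>) \<in> luxemburg M x"
        using sub[OF F(2), of "q + \<epsilon>"] cal0[OF F(2)] F \<epsilon> by simp
      moreover have "bdd_below (luxemburg M x)" by (rule bdd_belowI[of _ 0]) (auto simp: luxemburg_def)
      ultimately have "orlicz_norm M x \<le> C * (q + \<epsilon>)"
        unfolding orlicz_norm_eq by (rule cInf_lower)
      then show "orlicz_norm M x / C \<le> q + \<epsilon>" using C by (simp add: pos_divide_le_eq mult.commute)
    qed
    then show "(1 / C) * orlicz_norm M x \<le> q" by simp
  qed
  have upperN: "quotient_norm (Delta 0) (kernel_Delta k) x \<le> D * orlicz_norm M x"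
    if x: "x \<in> orlicz_space M" for x
  proof -
    have "quotient_norm (Delta 0) (kernel_Delta k) x / D \<le> orlicz_norm M x"
      unfolding orlicz_norm_eq
    proof (rule cInf_greatest)
      show "luxemburg M x \<noteq> {}" using luxemburg_nonempty[OF M x] by blast
      fix \<rho> assume "\<rho> \<in> luxemburg M x"
      then obtain F where F: "F \<in> kernel_Delta k" "Delta 0 F = x" "calderon_norm F \<le> D * \<rho>"
        using upper by blast
      have "bdd_below (?Q x)" using cal0 by (intro bdd_belowI[of _ 0]) auto
      moreover have "calderon_norm F \<in> ?Q x" using F by blast
      ultimately have "quotient_norm (Delta 0) (kernel_Delta k) x \<le> calderon_norm F"
        unfolding quotient_norm_def by (intro cInf_lower)
      with F(3) have "quotient_norm (Delta 0) (kernel_Delta k) x \<le> D * \<rho>" by linarith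
      then show "quotient_norm (Delta 0) (kernel_Delta k) x / D \<le> \<rho>"
        using D by (simp add: pos_divide_le_eq mult.commute)
    qed
    then show ?thesis using D by (simp add: pos_divide_le_eq mult.commute)
  qed
  show ?thesis
    unfolding equal_with_equivalent_norms_def
  proof (intro conjI exI ballI)
    show "Delta 0 ` kernel_Delta k = orlicz_space M" by (rule X)
    show "0 < 1 / C" using C by simp
    show "0 < D" by (rule D)
  qed (use lowerN upperN X in blast)+
qed

lemma kernel_Delta_1: "kernel_Delta 1 = ker_Delta 1"
  by (simp add: kernel_Delta_def ker_Delta_def)

lemma kernel_Delta_2: "kernel_Delta 2 = ker_Delta 1 \<inter> ker_Delta 2"
proof -
  have "{1..2} = {1, 2::nat}" by auto
  then show ?thesis unfolding kernel_Delta_def ker_Delta_def by auto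
qed

theorem proposition5p3:
  fixes f g :: "real \<Rightarrow> real"
  assumes "orlicz_function f"
    and "\<forall>\<^sub>F t in at_right 0. f t = t\<^sup>2 * ln t ^ 2"
    and "orlicz_function g"
    and "\<forall>\<^sub>F t in at_right 0. g t = t\<^sup>2 * ln t ^ 4"
  shows "equal_with_equivalent_norms
           (Delta 0 ` ker_Delta 1) (quotient_norm (Delta 0) (ker_Delta 1))
           (orlicz_space f) (orlicz_norm f) \<and>
         equal_with_equivalent_norms
           (Delta 0 ` (ker_Delta 1 \<inter> ker_Delta 2))
           (quotient_norm (Delta 0) (ker_Delta 1 \<inter> ker_Delta 2))
           (orlicz_space g) (orlicz_norm g)"
  using kernel_Delta_orlicz[of f 1] kernel_Delta_orlicz[of g 2] assms
  unfolding kernel_Delta_1 kernel_Delta_2 by simp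

end
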